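(* Let $1<p<2$, $\alpha>0$, let $\varphi$ be an entire function on $\mathbb{C}$, and let $X$ be a complex infinite-dimensional Banach space. Then $C_{\varphi}:wF^p_{\alpha}(X)\to F^p_{\alpha}(X)$ is bounded if and only if $\varphi(z)=az+b$ for some $a,b\in\mathbb{C}$ with $|a|<1$.
   Context: $dA$ is Lebesgue measure on $\mathbb{C}$. $F^p_\alpha$ is the space of scalar entire functions $f$ with $\|f\|^p_{F^p_{\alpha}}:=\int_{\mathbb{C}}|f(z)|^pe^{-\frac{p\alpha}{2}|z|^2}dA(z)<\infty$. $F^p_{\alpha}(X)$ is the space of $X$-valued entire functions $f$ with $\|f\|^p_{F^p_{\alpha}(X)}:=\int_{\mathbb{C}}\|f(z)\|^p_Xe^{-\frac{p\alpha}{2}|z|^2}dA(z)<\infty$. $wF^p_{\alpha}(X)$ is the space of $X$-valued entire functions $f$ with $\|f\|_{wF^p_{\alpha}(X)}:=\sup_{x^*\in B_{X^*}}\|x^*\circ f\|_{F^p_{\alpha}}<\infty$, where $B_{X^*}$ is the unit ball of $X^*$. For $X$-valued entire $f$, $C_\varphi f:=f\circ\varphi$. *)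

theory Defs
  imports "HOL-Analysis.Analysis"
begin

text \<open>The libraries have no complex normed spaces, so the complex scalar multiplication is added
  to the real Banach space class, compatibly with the real one.\<close>

class complex_banach = banach +
  fixes scaleC :: "complex \<Rightarrow> 'a \<Rightarrow> 'a" (infixr "*\<^sub>C" 75)
  assumes scaleC_add_right: "c *\<^sub>C (x + y) = c *\<^sub>C x + c *\<^sub>C y"
    and scaleC_add_left: "(c + d) *\<^sub>C x = c *\<^sub>C x + d *\<^sub>C x"
    and scaleC_scaleC: "c *\<^sub>C d *\<^sub>C x = (c * d) *\<^sub>C x"
    and scaleC_one: "1 *\<^sub>C x = x"
    and scaleC_of_real: "complex_of_real r *\<^sub>C x = r *\<^sub>R x"
    and norm_scaleC: "norm (c *\<^sub>C x) = cmod c * norm x"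

instantiation complex :: complex_banach
begin

definition scaleC_complex :: "complex \<Rightarrow> complex \<Rightarrow> complex" where
  "scaleC_complex c x = c * x"

instance
  by standard (auto simp: scaleC_complex_def algebra_simps norm_mult scaleR_conv_of_real)

end

lemma vector_space_scaleC: "vector_space (scaleC :: complex \<Rightarrow> 'a::complex_banach \<Rightarrow> 'a)"
  by unfold_locales (auto simp: scaleC_add_right scaleC_add_left scaleC_scaleC scaleC_one)

definition infinite_dimensional :: "'a::complex_banach itself \<Rightarrow> bool" where
  "infinite_dimensional _ \<longleftrightarrow>
     (\<nexists>B :: 'a set. finite B \<and> module.span scaleC B = UNIV)"

definition entire :: "(complex \<Rightarrow> 'a::complex_banach) \<Rightarrow> bool" where
  "entire f \<longleftrightarrow> (\<forall>z. \<exists>D. (f has_derivative (\<lambda>h. h *\<^sub>C D)) (at z))"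

lemma entire_complex_iff: "entire f \<longleftrightarrow> f holomorphic_on UNIV"
  for f :: "complex \<Rightarrow> complex"
  by (simp add: entire_def holomorphic_on_def field_differentiable_def
      has_field_derivative_def scaleC_complex_def mult.commute[of _ "_ :: complex"])

definition dual_unit_ball :: "('a::complex_banach \<Rightarrow> complex) set" where
  "dual_unit_ball =
     {x'. bounded_linear x' \<and> (\<forall>c x. x' (c *\<^sub>C x) = c * x' x) \<and> onorm x' \<le> 1}"

text \<open>The scalar spaces are the case where \<^typ>\<open>'a\<close> is \<^typ>\<open>complex\<close>.\<close>

definition fock_space :: "real \<Rightarrow> real \<Rightarrow> (complex \<Rightarrow> 'a::complex_banach) set" where
  "fock_space p \<alpha> =
     {f. entire f \<and>
         (\<integral>\<^sup>+z. ennreal (norm (f z) powr p * exp (- (p * \<alpha> / 2) * (cmod z)\<^sup>2)) \<partial>lborel) < \<infinity>}"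

text \<open>The norms are real-valued; they have their intended meaning on the corresponding space.\<close>

definition fock_norm :: "real \<Rightarrow> real \<Rightarrow> (complex \<Rightarrow> 'a::complex_banach) \<Rightarrow> real" where
  "fock_norm p \<alpha> f =
     (LINT z|lborel. norm (f z) powr p * exp (- (p * \<alpha> / 2) * (cmod z)\<^sup>2)) powr (1 / p)"

definition weak_fock_space :: "real \<Rightarrow> real \<Rightarrow> (complex \<Rightarrow> 'a::complex_banach) set" where
  "weak_fock_space p \<alpha> =
     {f. entire f \<and> (\<forall>x'\<in>dual_unit_ball. x' \<circ> f \<in> fock_space p \<alpha>) \<and>
         bdd_above ((\<lambda>x'. fock_norm p \<alpha> (x' \<circ> f)) ` dual_unit_ball)}"

definition weak_fock_norm :: "real \<Rightarrow> real \<Rightarrow> (complex \<Rightarrow> 'a::complex_banach) \<Rightarrow> real" where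
  "weak_fock_norm p \<alpha> f = (SUP x'\<in>dual_unit_ball. fock_norm p \<alpha> (x' \<circ> f))"

definition comp_op :: "(complex \<Rightarrow> complex) \<Rightarrow> (complex \<Rightarrow> 'a) \<Rightarrow> complex \<Rightarrow> 'a" where
  "comp_op \<phi> f = f \<circ> \<phi>"

definition bounded_weak_to_strong ::
    "real \<Rightarrow> real \<Rightarrow> ((complex \<Rightarrow> 'a::complex_banach) \<Rightarrow> complex \<Rightarrow> 'a) \<Rightarrow> bool" where
  "bounded_weak_to_strong p \<alpha> T \<longleftrightarrow>
     (\<forall>f\<in>weak_fock_space p \<alpha>. T f \<in> fock_space p \<alpha>) \<and>
     (\<exists>C. \<forall>f\<in>weak_fock_space p \<alpha>. fock_norm p \<alpha> (T f) \<le> C * weak_fock_norm p \<alpha> f)"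

end

theory Submission
  imports Defs "HOL-Probability.Distributions" "HOL-Probability.Discrete_Topology"
    "HOL-Complex_Analysis.Cauchy_Integral_Formula" "HOL-Real_Asymp.Real_Asymp"
begin

text \<open>If \<open>\<phi> z = a z + b\<close> with \<open>|a| < 1\<close>, the pointwise estimate
  \<open>\<parallel>f w\<parallel> \<le> C \<parallel>f\<parallel> exp (\<alpha> |w|\<^sup>2 / 2)\<close>, valid for the weak norm because \<open>X\<close> has norming functionals,
  already makes \<open>f \<circ> \<phi>\<close> integrable. Conversely, testing on normalised reproducing kernels gives
  \<open>|\<phi> z|\<^sup>2 \<le> |z|\<^sup>2 + M\<close>, so by Liouville either \<open>\<phi>\<close> is as claimed or \<open>\<phi> z = a z\<close> with \<open>|a| = 1\<close>.
  In the latter case take \<open>f = \<Sum>\<^sub>k k\<^bsub>w\<^sub>k\<^esub> x\<^sub>k\<close> with points \<open>w\<^sub>k\<close> so far apart that the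
  kernels behave like disjoint bumps: the strong norm is comparable to \<open>(\<Sum> \<parallel>x\<^sub>k\<parallel>\<^sup>p)\<^bsup>1/p\<^esup>\<close> and the weak norm
  at most a constant times \<open>sup (\<Sum> |x' x\<^sub>k|\<^sup>p)\<^bsup>1/p\<^esup>\<close>. Boundedness would therefore make the identity of
  \<open>X\<close> a \<open>p\<close>-summing operator. Pietsch domination by a finitely additive mean \<open>M\<close> on the dual ball then
  yields an inner product \<open>\<langle>x, y\<rangle> = M (Re (x' x \<cdot> cnj (x' y)))\<close> whose norm dominates that of \<open>X\<close>, and
  counting an orthonormal system of this inner product bounds the dimension of \<open>X\<close>.\<close>

section \<open>Hahn-Banach for sublinear functionals\<close>

text \<open>The hypothesis \<open>p < 2\<close> enters through \<open>powr_le_scaled_square\<close>.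
  Pietsch domination bounds norm x ^ p by K' times the mean of |x' x| ^ p, and for exponents below 2
  this mean can be traded for a quadratic one plus a part of norm x ^ p small enough to be absorbed
  on the left. Only a quadratic mean comes from an inner product. With respect to that inner product
  the real and imaginary parts of every x' in the dual ball have norm at most sqrt L, so by Bessel
  the sum of |x' e_k| ^ 2 is at most 2 * L, uniformly in x'. The mean of this sum is the number of
  orthonormal vectors. The obstacle in the rotation case is that the constants comparing kernel sums
  with l^p sums must not depend on the number of kernels, although their overlap grows with that
  number. The order of choices resolves this: \<delta> depends only on p and \<alpha>, then a finite
  family violating the summing inequality is taken, and only then, with its length known, the
  separation R.\<close>

definition sublinear :: "('a::real_vector \<Rightarrow> real) \<Rightarrow> bool" where
  "sublinear q \<longleftrightarrow> (\<forall>x y. q (x + y) \<le> q x + q y) \<and> (\<forall>c x. 0 \<le> c \<longrightarrow> q (c *\<^sub>R x) = c * q x)"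

text \<open>Half of homogeneity suffices: the inequality for \<open>inverse c\<close> applied to
  \<open>c *\<^sub>R x\<close> is the reverse inequality for c.\<close>

lemma sublinearI:
  assumes "\<And>x y. q (x + y) \<le> q x + q y" and "\<And>c x. 0 < c \<Longrightarrow> q (c *\<^sub>R x) \<le> c * q x" and "q 0 = 0"
  shows "sublinear q"
proof -
  have "q (c *\<^sub>R x) = c * q x" if c: "0 < c" for c x
  proof -
    have "q (inverse c *\<^sub>R c *\<^sub>R x) \<le> inverse c * q (c *\<^sub>R x)"
      using c by (intro assms(2)) simp
    then have "c * q x \<le> q (c *\<^sub>R x)"
      using c by (simp add: field_simps)
    then show ?thesis
      using assms(2)[OF c, of x] by simp
  qed
  then show ?thesis
    unfolding sublinear_def using assms(1,3) by (metis less_eq_real_def mult_zero_left scaleR_zero_left)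
qed

lemma sublinear_add: "sublinear q \<Longrightarrow> q (x + y) \<le> q x + q y"
  by (simp add: sublinear_def)

lemma sublinear_scaleR: "sublinear q \<Longrightarrow> 0 \<le> c \<Longrightarrow> q (c *\<^sub>R x) = c * q x"
  by (simp add: sublinear_def)

lemma sublinear_0: "sublinear q \<Longrightarrow> q 0 = 0"
  using sublinear_scaleR[of q 0 0] by simp

lemma sublinear_minus: "sublinear q \<Longrightarrow> - q (- x) \<le> q x"
  using sublinear_add[of q x "- x"] sublinear_0[of q] by simp

text \<open>The witness r x = inf over t \<ge> 0 of q (x + t v) - t q v is the largest sublinear
  minorant of q whose value at - v is at most - q v.\<close>

lemma sublinear_descend:
  fixes q :: "'a::real_vector \<Rightarrow> real"
  assumes q: "sublinear q"
  obtains r where "sublinear r" "r \<le> q" "r (- v) \<le> - q v"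
proof
  define S where "S x = (\<lambda>t. q (x + t *\<^sub>R v) - t * q v) ` {0..}" for x
  define r where "r x = Inf (S x)" for x
  have bdd: "bdd_below (S x)" for x
  proof (rule bdd_belowI)
    fix y assume "y \<in> S x"
    then obtain t where t: "0 \<le> t" "y = q (x + t *\<^sub>R v) - t * q v"
      by (auto simp: S_def)
    have "q (t *\<^sub>R v) \<le> q (x + t *\<^sub>R v) + q (- x)"
      using sublinear_add[OF q, of "x + t *\<^sub>R v" "- x"] by simp
    then show "- q (- x) \<le> y"
      using t sublinear_scaleR[OF q] by simp
  qed
  have le: "r x \<le> q (x + t *\<^sub>R v) - t * q v" if "0 \<le> t" for x t
    unfolding r_def using that by (intro cInf_lower bdd) (auto simp: S_def)
  have ge: "c \<le> r x" if "\<And>t. 0 \<le> t \<Longrightarrow> c \<le> q (x + t *\<^sub>R v) - t * q v" for x c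
    unfolding r_def by (rule cInf_greatest) (auto simp: S_def that)
  show "r \<le> q"
    using le[of 0] by (simp add: le_fun_def)
  show "r (- v) \<le> - q v"
    using le[of 1 "- v"] sublinear_0[OF q] by simp
  show "sublinear r"
  proof (rule sublinearI)
    fix x y
    have "r (x + y) - (q (x + t *\<^sub>R v) - t * q v) \<le> r y" if t: "0 \<le> t" for t
    proof (rule ge)
      fix s :: real assume s: "0 \<le> s"
      have "r (x + y) \<le> q ((x + y) + (t + s) *\<^sub>R v) - (t + s) * q v"
        using s t by (intro le) simp
      also have "q ((x + y) + (t + s) *\<^sub>R v) \<le> q (x + t *\<^sub>R v) + q (y + s *\<^sub>R v)"
        using sublinear_add[OF q, of "x + t *\<^sub>R v" "y + s *\<^sub>R v"] by (simp add: algebra_simps)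
      finally show "r (x + y) - (q (x + t *\<^sub>R v) - t * q v) \<le> q (y + s *\<^sub>R v) - s * q v"
        by (simp add: algebra_simps)
    qed
    then have "r (x + y) - r y \<le> r x"
      by (intro ge) (simp add: algebra_simps)
    then show "r (x + y) \<le> r x + r y" by simp
  next
    fix c :: real and x :: 'a assume c: "0 < c"
    have "inverse c * r (c *\<^sub>R x) \<le> r x"
    proof (rule ge)
      fix t :: real assume t: "0 \<le> t"
      have "r (c *\<^sub>R x) \<le> q (c *\<^sub>R x + (c * t) *\<^sub>R v) - c * t * q v"
        using c t by (intro le) simp
      also have "q (c *\<^sub>R x + (c * t) *\<^sub>R v) = c * q (x + t *\<^sub>R v)"
        using sublinear_scaleR[OF q, of c "x + t *\<^sub>R v"] c by (simp add: algebra_simps)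
      finally show "inverse c * r (c *\<^sub>R x) \<le> q (x + t *\<^sub>R v) - t * q v"
        using c by (simp add: field_simps)
    qed
    then show "r (c *\<^sub>R x) \<le> c * r x"
      using c by (simp add: field_simps)
  next
    have "0 \<le> r 0"
      using sublinear_scaleR[OF q] by (intro ge) simp
    moreover have "r 0 \<le> 0"
      using le[of 0 0] sublinear_0[OF q] by simp
    ultimately show "r 0 = 0" by simp
  qed
qed

text \<open>The lower bound that Zorn's lemma asks for is the pointwise infimum. It is finite
  because members below a fixed q0 satisfy q x \<ge> - q (- x) \<ge> - q0 (- x), and it is
  subadditive because two members of a chain have a common minorant in the chain.\<close>

lemma sublinear_chain_Inf:
  fixes C :: "('a::real_vector \<Rightarrow> real) set"
  assumes ne: "C \<noteq> {}" and sub: "\<And>q. q \<in> C \<Longrightarrow> sublinear q"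
    and chain: "\<And>q r. q \<in> C \<Longrightarrow> r \<in> C \<Longrightarrow> q \<le> r \<or> r \<le> q"
  obtains u where "sublinear u" "\<And>q. q \<in> C \<Longrightarrow> u \<le> q"
proof
  obtain q0 where q0: "q0 \<in> C" using ne by blast
  define u where "u x = (INF q\<in>C. q x)" for x
  have bdd: "bdd_below ((\<lambda>q. q x) ` C)" for x
  proof (rule bdd_belowI2)
    fix q assume qC: "q \<in> C"
    have "- q0 (- x) \<le> q0 x" "- q (- x) \<le> q x"
      using sub q0 qC sublinear_minus by auto
    moreover have "q0 x \<le> q x \<or> q (- x) \<le> q0 (- x)"
      using chain[OF q0 qC] by (auto simp: le_fun_def)
    ultimately show "min (- q0 (- x)) (q0 x) \<le> q x" by linarith
  qed
  have le: "u x \<le> q x" if "q \<in> C" for x q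
    unfolding u_def using that by (intro cINF_lower bdd)
  have ge: "c \<le> u x" if "\<And>q. q \<in> C \<Longrightarrow> c \<le> q x" for x c
    unfolding u_def using that ne by (intro cINF_greatest)
  show "u \<le> q" if "q \<in> C" for q
    using le[OF that] by (simp add: le_fun_def)
  show "sublinear u"
  proof (rule sublinearI)
    fix x y
    have *: "u (x + y) \<le> q x + r y" if qr: "q \<in> C" "r \<in> C" for q r
    proof -
      have "\<exists>s\<in>C. s \<le> q \<and> s \<le> r" using chain[OF qr] qr by auto
      then obtain s where s: "s \<in> C" "s x \<le> q x" "s y \<le> r y" by (auto simp: le_fun_def)
      have "u (x + y) \<le> s x + s y"
        using le[OF s(1), of "x + y"] sublinear_add[OF sub[OF s(1)], of x y] by linarith
      then show ?thesis using s by linarith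
    qed
    have "u (x + y) - q x \<le> u y" if "q \<in> C" for q
      using *[OF that] by (intro ge) (simp add: algebra_simps)
    then have "u (x + y) - u y \<le> u x"
      by (intro ge) (simp add: algebra_simps)
    then show "u (x + y) \<le> u x + u y" by simp
  next
    fix c :: real and x assume c: "0 < c"
    have "inverse c * u (c *\<^sub>R x) \<le> u x"
    proof (rule ge)
      fix q assume "q \<in> C"
      then show "inverse c * u (c *\<^sub>R x) \<le> q x"
        using le[of q "c *\<^sub>R x"] sublinear_scaleR[OF sub, of q c x] c by (simp add: field_simps)
    qed
    then show "u (c *\<^sub>R x) \<le> c * u x"
      using c by (simp add: field_simps)
  next
    show "u 0 = 0"
      using le[OF q0, of 0] ge[of 0 0] sublinear_0[OF sub] q0 by force
  qed
qed

lemma minimal_sublinear: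
  fixes q :: "'a::real_vector \<Rightarrow> real"
  assumes q: "sublinear q"
  obtains f where "sublinear f" "f \<le> q" "\<And>r. sublinear r \<Longrightarrow> r \<le> f \<Longrightarrow> r = f"
proof -
  let ?A = "{r. sublinear r \<and> r \<le> q}" and ?P = "\<lambda>r s :: 'a \<Rightarrow> real. s \<le> r"
  have "\<exists>m\<in>?A. \<forall>a\<in>?A. ?P m a \<longrightarrow> a = m"
  proof (rule predicate_Zorn)
    show "partial_order_on ?A (relation_of ?P ?A)"
      by (rule partial_order_on_relation_ofI) auto
  next
    fix C assume C: "C \<in> Chains (relation_of ?P ?A)"
    then have CA: "r \<in> ?A" if "r \<in> C" for r
      using that by (auto simp: Chains_def relation_of_def)
    show "\<exists>u\<in>?A. \<forall>a\<in>C. ?P a u"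
    proof (cases "C = {}")
      case True
      then show ?thesis using q by auto
    next
      case False
      then obtain r0 where r0: "r0 \<in> C" by blast
      obtain u where "sublinear u" "\<And>r. r \<in> C \<Longrightarrow> u \<le> r"
      proof (rule sublinear_chain_Inf[OF False])
        show "r \<le> s \<or> s \<le> r" if "r \<in> C" "s \<in> C" for r s
          using C that by (auto simp: Chains_def relation_of_def)
      qed (use CA in auto)
      moreover from this have "u \<le> q"
        using CA[OF r0] r0 order_trans by blast
      ultimately show ?thesis by blast
    qed
  qed
  then obtain f where f: "sublinear f" "f \<le> q" "\<And>r. sublinear r \<Longrightarrow> r \<le> q \<Longrightarrow> r \<le> f \<Longrightarrow> r = f"
    by blast
  then show ?thesis
    using that order_trans by blast
qed

text \<open>A minimal sublinear functional is linear. Starting the descent from a functional \<open>r \<le> q\<close> with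
  \<open>r (- v) \<le> - q v\<close> forces equality at \<open>v\<close>.\<close>

theorem Hahn_Banach_sublinear:
  fixes q :: "'a::real_vector \<Rightarrow> real"
  assumes q: "sublinear q"
  obtains f where "linear f" "\<And>x. f x \<le> q x" "f v = q v"
proof -
  obtain r where r: "sublinear r" "r \<le> q" "r (- v) \<le> - q v"
    using sublinear_descend[OF q] by blast
  obtain f where f: "sublinear f" "f \<le> r" and min: "\<And>s. sublinear s \<Longrightarrow> s \<le> f \<Longrightarrow> s = f"
    using minimal_sublinear[OF r(1)] by blast
  \<comment> \<open>By minimality the descent from f at x returns f itself, so f inherits the
    inequality at - x. Oddness then turns subadditivity into additivity.\<close>
  have neg: "f (- x) = - f x" for x
  proof -
    obtain s where "sublinear s" "s \<le> f" "s (- x) \<le> - f x"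
      using sublinear_descend[OF f(1)] by blast
    then have "f (- x) \<le> - f x"
      using min by blast
    then show ?thesis
      using sublinear_minus[OF f(1), of x] by simp
  qed
  have "linear f"
  proof (rule linearI)
    fix x y
    have "f x \<le> f (x + y) + f (- y)"
      using sublinear_add[OF f(1), of "x + y" "- y"] by simp
    then show "f (x + y) = f x + f y"
      using sublinear_add[OF f(1), of x y] neg[of y] by simp
  next
    fix c :: real and x
    show "f (c *\<^sub>R x) = c *\<^sub>R f x"
    proof (cases "0 \<le> c")
      case True
      then show ?thesis using sublinear_scaleR[OF f(1)] by simp
    next
      case False
      then have "f ((- c) *\<^sub>R x) = (- c) * f x"
        by (intro sublinear_scaleR f) simp
      then show ?thesis using neg[of "c *\<^sub>R x"] by simp
    qed
  qed
  moreover have "f x \<le> q x" for x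
    using f(2) r(2) by (metis le_funD order_trans)
  moreover have "q v \<le> f v"
    using neg[of v] le_funD[OF f(2), of "- v"] r(3) by linarith
  ultimately show ?thesis
    using that by (metis order_antisym)
qed

section \<open>The dual unit ball\<close>

lemma dual_unit_ballI:
  fixes x' :: "'a::complex_banach \<Rightarrow> complex"
  assumes add: "\<And>x y. x' (x + y) = x' x + x' y" and scale: "\<And>c x. x' (c *\<^sub>C x) = c * x' x"
    and le: "\<And>x. cmod (x' x) \<le> norm x"
  shows "x' \<in> dual_unit_ball"
proof -
  have "bounded_linear x'"
  proof (rule bounded_linear_intro[where K = 1])
    show "x' (r *\<^sub>R x) = r *\<^sub>R x' x" for r x
      using scale[of "complex_of_real r" x] by (simp add: scaleC_of_real scaleR_conv_of_real)
  qed (use add le in auto)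
  moreover have "onorm x' \<le> 1"
    using le by (intro onorm_bound) auto
  ultimately show ?thesis
    using scale by (simp add: dual_unit_ball_def)
qed

lemma dual_unit_ball_bounded_linear: "x' \<in> dual_unit_ball \<Longrightarrow> bounded_linear x'"
  by (simp add: dual_unit_ball_def)

lemma dual_unit_ball_scaleC: "x' \<in> dual_unit_ball \<Longrightarrow> x' (c *\<^sub>C x) = c * x' x"
  by (simp add: dual_unit_ball_def)

lemma dual_unit_ball_le: "x' \<in> dual_unit_ball \<Longrightarrow> cmod (x' x) \<le> norm x"
  using onorm[of x' x] mult_right_mono[of "onorm x'" 1 "norm x"]
  by (fastforce simp: dual_unit_ball_def)

lemma zero_in_dual_unit_ball: "(\<lambda>_. 0) \<in> dual_unit_ball"
  by (rule dual_unit_ballI) auto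

text \<open>The real Hahn-Banach functional g for the norm is made complex linear by the usual
  formula x' x = g x - i g (i x), whose imaginary part is forced by complex linearity.\<close>

lemma norming_functional:
  fixes v :: "'a::complex_banach"
  obtains x' where "x' \<in> dual_unit_ball" "cmod (x' v) = norm v"
proof -
  have "sublinear (norm :: 'a \<Rightarrow> real)"
    by (simp add: sublinear_def norm_triangle_ineq)
  then obtain g :: "'a \<Rightarrow> real" where g: "linear g" "\<And>x. g x \<le> norm x" "g v = norm v"
    using Hahn_Banach_sublinear[of norm v] by metis
  define x' where "x' x = Complex (g x) (- g (\<i> *\<^sub>C x))" for x
  have gR: "g (complex_of_real r *\<^sub>C x) = r * g x" for r x
    using linear_cmul[OF g(1)] by (simp add: scaleC_of_real)
  have add: "x' (x + y) = x' x + x' y" for x y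
    by (simp add: x'_def linear_add[OF g(1)] scaleC_add_right complex_eq_iff)
  have scale: "x' (c *\<^sub>C x) = c * x' x" for c x
  proof -
    have c: "c = complex_of_real (Re c) + complex_of_real (Im c) * \<i>"
      by (simp add: complex_eq_iff)
    have "g (c *\<^sub>C x) = Re c * g x + Im c * g (\<i> *\<^sub>C x)" for x
      by (subst c) (simp only: scaleC_add_left linear_add[OF g(1)] scaleC_scaleC[symmetric] gR)
    from this[of x] this[of "\<i> *\<^sub>C x"] show ?thesis
      using gR[of "-1" x]
      by (simp add: x'_def complex_eq_iff scaleC_scaleC mult.commute[of \<i> c])
  qed
  have "cmod (x' x) \<le> norm x" for x
  proof (cases "x' x = 0")
    case False
    \<comment> \<open>A unimodular factor that makes x' (c x) real and nonnegative, so that the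
      bound for the real part g bounds the modulus.\<close>
    define c where "c = cnj (x' x) / cmod (x' x)"
    have c: "cmod c = 1" "c * x' x = complex_of_real (cmod (x' x))"
      using False by (auto simp: c_def norm_divide complex_norm_square[symmetric] power2_eq_square field_simps)
    have "cmod (x' x) = Re (x' (c *\<^sub>C x))"
      by (simp add: scale c)
    also have "\<dots> \<le> norm (c *\<^sub>C x)"
      using g(2) by (simp add: x'_def)
    finally show ?thesis
      by (simp add: norm_scaleC c)
  qed simp
  then have x': "x' \<in> dual_unit_ball"
    using add scale by (intro dual_unit_ballI) auto
  moreover have "norm v \<le> cmod (x' v)"
    using complex_Re_le_cmod[of "x' v"] by (simp add: x'_def g(3))
  ultimately show ?thesis
    using that dual_unit_ball_le by (metis order_antisym)
qed

section \<open>The identity of an infinite-dimensional space is not summing\<close>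

text \<open>Pietsch domination with a finitely additive mean \<open>M\<close> in place of a measure, so that no weak-star
  compactness is needed: \<open>M\<close> lies below \<open>h \<mapsto> inf\<^bsub>g \<in> F\<^esub> sup\<^bsub>B\<^esub> (h + g)\<close>. The type \<open>'b discrete\<close>
  turns the bounded functions on \<open>B\<close> into a vector space type; \<open>M\<close> is meaningful on functions bounded
  on \<open>B\<close> only.\<close>

lemma dominated_mean_exists:
  fixes B :: "'b set" and F :: "('b \<Rightarrow> real) set"
  assumes bdd: "\<And>g. g \<in> F \<Longrightarrow> bounded (g ` B)"
    and zero: "(\<lambda>_. 0) \<in> F"
    and add: "\<And>g h. g \<in> F \<Longrightarrow> h \<in> F \<Longrightarrow> (\<lambda>b. g b + h b) \<in> F"
    and scale: "\<And>c g. 0 < c \<Longrightarrow> g \<in> F \<Longrightarrow> (\<lambda>b. c * g b) \<in> F"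
    and nonneg: "\<And>g m. g \<in> F \<Longrightarrow> (\<And>b. b \<in> B \<Longrightarrow> g b \<le> m) \<Longrightarrow> 0 \<le> m"
  shows "\<exists>M :: ('b \<Rightarrow> real) \<Rightarrow> real.
    (\<forall>g h. bounded (g ` B) \<longrightarrow> bounded (h ` B) \<longrightarrow> M (\<lambda>b. g b + h b) = M g + M h) \<and>
    (\<forall>c g. bounded (g ` B) \<longrightarrow> M (\<lambda>b. c * g b) = c * M g) \<and>
    (\<forall>g m. bounded (g ` B) \<longrightarrow> (\<forall>b\<in>B. g b \<le> m) \<longrightarrow> M g \<le> m) \<and>
    (\<forall>g\<in>F. 0 \<le> M g)"
proof -
  \<comment> \<open>All upper bounds on B of the functions h + g with g in F; the infimum of
    \<open>S h\<close> is thus the inf-sup expression for q without naming suprema.\<close>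
  define S :: "('b discrete \<Rightarrow>\<^sub>C real) \<Rightarrow> real set"
    where "S h = {m. \<exists>g\<in>F. \<forall>b\<in>B. h (discrete b) + g b \<le> m}" for h
  define q where "q h = Inf (S h)" for h
  have lower: "- norm h \<le> m" if "m \<in> S h" for h m
  proof -
    obtain g where g: "g \<in> F" "\<And>b. b \<in> B \<Longrightarrow> h (discrete b) + g b \<le> m"
      using \<open>m \<in> S h\<close> by (auto simp: S_def)
    have "g b \<le> m + norm h" if "b \<in> B" for b
      using g(2)[OF that] norm_bounded[of h "discrete b"] by auto
    then show ?thesis
      using nonneg[OF g(1)] by force
  qed
  have bddS: "bdd_below (S h)" for h
    using lower by (rule bdd_belowI)
  have neS: "S h \<noteq> {}" for h
  proof -
    have "norm h \<in> S h"
      using zero norm_bounded[of h] by (force simp: S_def abs_le_iff)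
    then show ?thesis by blast
  qed
  have le: "q h \<le> m" if "m \<in> S h" for h m
    unfolding q_def using that bddS by (rule cInf_lower)
  have ge: "c \<le> q h" if "\<And>m. m \<in> S h \<Longrightarrow> c \<le> m" for h c
    unfolding q_def using neS that by (rule cInf_greatest)
  have "sublinear q"
  proof (rule sublinearI)
    fix h k
    have "m + l \<in> S (h + k)" if ml: "m \<in> S h" "l \<in> S k" for m l
    proof -
      obtain f g where "f \<in> F" "g \<in> F"
        and fg: "\<forall>b\<in>B. h (discrete b) + f b \<le> m" "\<forall>b\<in>B. k (discrete b) + g b \<le> l"
        using ml by (auto simp: S_def)
      moreover have "(h + k) (discrete b) + (f b + g b) \<le> m + l" if "b \<in> B" for b
        using fg[THEN bspec, OF that] by (simp add: plus_bcontfun.rep_eq)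
      ultimately show ?thesis
        using add[of f g] by (auto simp: S_def intro!: bexI[of _ "\<lambda>b. f b + g b"])
    qed
    then have *: "q (h + k) \<le> m + l" if "m \<in> S h" "l \<in> S k" for m l
      using that le by blast
    have "q (h + k) - m \<le> q k" if "m \<in> S h" for m
      using *[OF that] by (intro ge) (simp add: diff_le_eq add.commute)
    then have "q (h + k) - q k \<le> q h"
      by (intro ge) (simp add: algebra_simps)
    then show "q (h + k) \<le> q h + q k" by simp
  next
    fix c :: real and h assume c: "0 < c"
    have "c * m \<in> S (c *\<^sub>R h)" if m: "m \<in> S h" for m
    proof -
      obtain g where g: "g \<in> F" "\<forall>b\<in>B. h (discrete b) + g b \<le> m"
        using m by (auto simp: S_def)
      have "(c *\<^sub>R h) (discrete b) + c * g b \<le> c * m" if "b \<in> B" for b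
        using mult_left_mono[OF g(2)[rule_format, OF that], of c] c
        by (simp add: scaleR_bcontfun.rep_eq algebra_simps)
      then show ?thesis
        using scale[OF c g(1)] by (auto simp: S_def intro!: bexI[of _ "\<lambda>b. c * g b"])
    qed
    then have "inverse c * q (c *\<^sub>R h) \<le> q h"
      using c le by (intro ge) (simp add: field_simps)
    then show "q (c *\<^sub>R h) \<le> c * q h"
      using c by (simp add: field_simps)
  next
    have "0 \<in> S 0"
      using zero by (force simp: S_def)
    then have "q 0 \<le> 0" by (rule le)
    moreover have "0 \<le> q 0"
      using lower[of _ 0] by (intro ge) simp
    ultimately show "q 0 = 0" by simp
  qed
  then obtain f where f: "linear f" "\<And>h. f h \<le> q h"
    using Hahn_Banach_sublinear by metis
  \<comment> \<open>Extension by zero outside B makes a function bounded on B bounded everywhere; on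
    the discrete type continuity is automatic.\<close>
  define lift :: "('b \<Rightarrow> real) \<Rightarrow> 'b discrete \<Rightarrow>\<^sub>C real"
    where "lift g = Bcontfun (\<lambda>d. if of_discrete d \<in> B then g (of_discrete d) else 0)" for g
  have lift: "lift g d = (if of_discrete d \<in> B then g (of_discrete d) else 0)"
    if g: "bounded (g ` B)" for g d
  proof -
    obtain m where m: "\<And>b. b \<in> B \<Longrightarrow> norm (g b) \<le> m"
      using g by (auto simp: bounded_iff)
    have "(\<lambda>d. if of_discrete d \<in> B then g (of_discrete d) else 0) \<in> bcontfun"
    proof (rule bcontfun_normI)
      show "continuous_on UNIV (\<lambda>d. if of_discrete d \<in> B then g (of_discrete d) else 0)"
        by (simp add: continuous_on_open_vimage open_discrete)
      show "norm (if of_discrete d \<in> B then g (of_discrete d) else 0) \<le> max m 0" for d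
        using m[of "of_discrete d"] by auto
    qed
    then show ?thesis
      by (simp add: lift_def Bcontfun_inverse)
  qed
  show ?thesis
  proof (intro exI[of _ "\<lambda>g. f (lift g)"] conjI allI ballI impI)
    fix g h :: "'b \<Rightarrow> real" assume g: "bounded (g ` B)" and h: "bounded (h ` B)"
    have "lift (\<lambda>b. g b + h b) = lift g + lift h"
      by (rule bcontfun_eqI) (simp add: lift g h bounded_plus_comp plus_bcontfun.rep_eq)
    then show "f (lift (\<lambda>b. g b + h b)) = f (lift g) + f (lift h)"
      by (simp add: linear_add[OF f(1)])
  next
    fix g :: "'b \<Rightarrow> real" and c :: real assume g: "bounded (g ` B)"
    have "bounded ((\<lambda>b. c * g b) ` B)"
      using bounded_scaling[OF g, of c] by (simp add: image_image)
    then have "lift (\<lambda>b. c * g b) = c *\<^sub>R lift g"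
      by (intro bcontfun_eqI) (simp add: lift g scaleR_bcontfun.rep_eq)
    then show "f (lift (\<lambda>b. c * g b)) = c * f (lift g)"
      by (simp add: linear_cmul[OF f(1)])
  next
    fix g :: "'b \<Rightarrow> real" and m assume g: "bounded (g ` B)" and m: "\<forall>b\<in>B. g b \<le> m"
    have "m \<in> S (lift g)"
      using zero m by (force simp: S_def lift g discrete_inverse)
    then show "f (lift g) \<le> m"
      using le f(2) order_trans by blast
  next
    fix g assume g: "g \<in> F"
    \<comment> \<open>The witness is g itself: - g + g = 0 on B, hence q is at most 0 at -
      g.\<close>
    have "0 \<in> S (- lift g)"
      using g by (force simp: S_def lift bdd discrete_inverse uminus_bcontfun.rep_eq)
    then have "f (- lift g) \<le> 0"
      using le f(2) order_trans by blast
    then show "0 \<le> f (lift g)"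
      by (simp add: linear_neg[OF f(1)])
  qed
qed

text \<open>Gram-Schmidt for a real inner product. Infinite dimension is over the complex numbers,
  so the new vector is taken outside the complex span, which contains the real combination that is
  subtracted.\<close>

lemma orthonormal_exists:
  fixes ip :: "'a::complex_banach \<Rightarrow> 'a \<Rightarrow> real"
  assumes inf: "infinite_dimensional TYPE('a)"
    and lin: "\<And>y. linear (\<lambda>x. ip x y)" and sym: "\<And>x y. ip x y = ip y x"
    and pos: "\<And>x. x \<noteq> 0 \<Longrightarrow> 0 < ip x x"
  shows "\<exists>e :: nat \<Rightarrow> 'a. \<forall>i<n. \<forall>j<n. ip (e i) (e j) = of_bool (i = j)"
proof (induction n)
  case (Suc n)
  then obtain e :: "nat \<Rightarrow> 'a" where e: "\<And>i j. i < n \<Longrightarrow> j < n \<Longrightarrow> ip (e i) (e j) = of_bool (i = j)"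
    by blast
  interpret vector_space "scaleC :: complex \<Rightarrow> 'a \<Rightarrow> 'a"
    by (rule vector_space_scaleC)
  have "span (e ` {..<n}) \<noteq> UNIV"
    using inf by (simp add: infinite_dimensional_def)
  then obtain x where x: "x \<notin> span (e ` {..<n})"
    by blast
  define y where "y = x - (\<Sum>k<n. ip x (e k) *\<^sub>R e k)"
  have "r *\<^sub>R e k \<in> span (e ` {..<n})" if "k < n" for r k
    using that span_scale[OF span_base, of "e k" "e ` {..<n}" "complex_of_real r"]
    by (simp add: scaleC_of_real)
  then have "(\<Sum>k<n. ip x (e k) *\<^sub>R e k) \<in> span (e ` {..<n})"
    by (intro span_sum) auto
  then have "y \<notin> span (e ` {..<n})"
    using x span_add[of y _ "\<Sum>k<n. ip x (e k) *\<^sub>R e k"] by (auto simp: y_def)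
  then have "y \<noteq> 0"
    using span_zero by blast
  then have y: "0 < ip y y" by (rule pos)
  have yj: "ip y (e j) = 0" if "j < n" for j
  proof -
    have "ip y (e j) = ip x (e j) - (\<Sum>k<n. ip x (e k) * ip (e k) (e j))"
      by (simp add: y_def linear_diff[OF lin] linear_sum[OF lin] linear_cmul[OF lin])
    also have "(\<Sum>k<n. ip x (e k) * ip (e k) (e j)) = (\<Sum>k<n. if k = j then ip x (e k) else 0)"
      using e that by (intro sum.cong) auto
    finally show ?thesis
      using that by simp
  qed
  define u where "u = (1 / sqrt (ip y y)) *\<^sub>R y"
  have uj: "ip u (e j) = 0" "ip (e j) u = 0" if "j < n" for j
    using yj[OF that] sym[of "e j" u] by (simp_all add: u_def linear_cmul[OF lin])
  have "ip u u = 1 / sqrt (ip y y) * (1 / sqrt (ip y y) * ip y y)"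
    using sym[of y u] by (simp add: u_def linear_cmul[OF lin])
  then have "ip u u = ip y y / (sqrt (ip y y) * sqrt (ip y y))"
    by simp
  then have uu: "ip u u = 1"
    using y by simp
  show ?case
  proof (intro exI[of _ "e(n := u)"] allI impI)
    fix i j assume "i < Suc n" "j < Suc n"
    then show "ip ((e(n := u)) i) ((e(n := u)) j) = of_bool (i = j)"
      using e uj uu by (cases "i = n"; cases "j = n") simp_all
  qed
qed simp

text \<open>Bessel's inequality for a functional of norm at most sqrt L: for y = sum of g (e k) e k
  both g y and ip y y equal the sum s, whence s ^ 2 \<le> norm y ^ 2 \<le> L * s.\<close>

lemma orthonormal_sum_square_le:
  fixes ip :: "'a::real_normed_vector \<Rightarrow> 'a \<Rightarrow> real" and e :: "nat \<Rightarrow> 'a"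
  assumes lin: "\<And>y. linear (\<lambda>x. ip x y)" and sym: "\<And>x y. ip x y = ip y x"
    and norm: "\<And>x. (norm x)\<^sup>2 \<le> L * ip x x" and L: "0 \<le> L"
    and e: "\<And>i j. i < n \<Longrightarrow> j < n \<Longrightarrow> ip (e i) (e j) = of_bool (i = j)"
    and g: "linear g" "\<And>x. g x \<le> norm x"
  shows "(\<Sum>k<n. (g (e k))\<^sup>2) \<le> L"
proof -
  define y where "y = (\<Sum>k<n. g (e k) *\<^sub>R e k)"
  define s where "s = (\<Sum>k<n. (g (e k))\<^sup>2)"
  have "0 \<le> s"
    by (simp add: s_def sum_nonneg)
  have "ip y (e j) = g (e j)" if "j < n" for j
  proof -
    have "ip y (e j) = (\<Sum>k<n. g (e k) * ip (e k) (e j))"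
      by (simp add: y_def linear_sum[OF lin] linear_cmul[OF lin])
    also have "\<dots> = (\<Sum>k<n. if k = j then g (e k) else 0)"
      using e that by (intro sum.cong) auto
    finally show ?thesis
      using that by simp
  qed
  then have "ip y y = s"
    using sym[of y] by (subst (1) y_def) (simp add: linear_sum[OF lin] linear_cmul[OF lin] s_def power2_eq_square)
  moreover have gy: "g y = s"
    by (simp add: y_def linear_sum[OF g(1)] linear_cmul[OF g(1)] s_def power2_eq_square)
  moreover from this have "s\<^sup>2 \<le> (norm y)\<^sup>2"
    using g(2)[of y] \<open>0 \<le> s\<close> by (intro power_mono) simp_all
  ultimately have "s\<^sup>2 \<le> L * s"
    using norm[of y] by simp
  then have "s \<le> L" if "s \<noteq> 0"
    using that \<open>0 \<le> s\<close> by (simp add: power2_eq_square)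
  then show ?thesis
    using L unfolding s_def[symmetric] by (cases "s = 0") simp_all
qed

text \<open>For t \<le> s the second term alone suffices; for t > s the first does, because the
  exponent p - 2 is negative. The scale s is free, so the second term can be made small enough to
  absorb.\<close>

lemma powr_le_scaled_square:
  fixes s t p :: real
  assumes "0 < s" "0 \<le> t" "1 < p" "p < 2"
  shows "t powr p \<le> s powr (p - 2) * t\<^sup>2 + s powr p"
proof (cases "t \<le> s")
  case True
  then have "t powr p \<le> s powr p"
    using assms by (intro powr_mono2) auto
  then show ?thesis
    by (simp add: add_increasing)
next
  case False
  then have "t powr p = t powr (p - 2) * t\<^sup>2"
    using assms powr_add[of t "p - 2" 2] by simp
  also have "\<dots> \<le> s powr (p - 2) * t\<^sup>2"
    using assms False by (intro mult_right_mono powr_mono2') auto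
  finally show ?thesis
    by (simp add: add_increasing2)
qed

text \<open>Families are lists, with repetitions, so that concatenating two of them adds the
  associated functions in the cone F.\<close>

theorem identity_not_summing:
  assumes inf: "infinite_dimensional TYPE('a::complex_banach)" and p: "1 < p" "p < 2"
  shows "\<exists>(xs :: 'a list) S. (\<forall>x'\<in>dual_unit_ball. (\<Sum>x\<leftarrow>xs. cmod (x' x) powr p) \<le> S)
           \<and> K * S < (\<Sum>x\<leftarrow>xs. norm x powr p)"
proof (rule ccontr)
  assume neg: "\<not> ?thesis"
  define B :: "('a \<Rightarrow> complex) set" where "B = dual_unit_ball"
  \<comment> \<open>Positivity allows division by the constant. Enlarging K keeps the inequality
    because S is nonnegative: the zero functional lies in the ball.\<close>
  define K' where "K' = max K 1"
  have K': "0 < K'" by (simp add: K'_def)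
  have summing: "(\<Sum>x\<leftarrow>xs. norm x powr p) \<le> K' * S"
    if "\<And>x'. x' \<in> B \<Longrightarrow> (\<Sum>x\<leftarrow>xs. cmod (x' x) powr p) \<le> S" for xs :: "'a list" and S
  proof -
    have "0 \<le> (\<Sum>x\<leftarrow>xs. cmod (0 :: complex) powr p)"
      by (intro sum_list_nonneg) auto
    then have "0 \<le> S"
      using that[of "\<lambda>_. 0"] zero_in_dual_unit_ball by (auto simp: B_def)
    have "(\<Sum>x\<leftarrow>xs. norm x powr p) \<le> K * S"
      using neg that unfolding B_def by (meson not_le)
    also have "K * S \<le> K' * S"
      using \<open>0 \<le> S\<close> by (intro mult_right_mono) (auto simp: K'_def)
    finally show ?thesis .
  qed
  have le: "cmod (x' x) \<le> norm x" if "x' \<in> B" for x' and x :: 'a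
    using that dual_unit_ball_le by (auto simp: B_def)
  define c where "c xs x' = (\<Sum>x\<leftarrow>xs. K' * cmod (x' x) powr p - norm x powr p)"
    for xs :: "'a list" and x' :: "'a \<Rightarrow> complex"
  have bdd_powr: "bounded ((\<lambda>x'. cmod (x' x) powr p) ` B)" for x :: 'a
    by (rule boundedI[where B = "norm x powr p"]) (use le p in \<open>auto intro!: powr_mono2\<close>)
  have bdd_c: "bounded (c xs ` B)" for xs
  proof (induction xs)
    case (Cons x xs)
    have "bounded ((\<lambda>x'. K' * cmod (x' x) powr p + - (norm x powr p)) ` B)"
      using bounded_scaling[OF bdd_powr[of x], of K']
      by (intro bounded_plus_comp) (auto simp: image_image bounded_iff)
    then show ?case
      using bounded_plus_comp[OF _ Cons] by (simp add: c_def[abs_def])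
  next
    case Nil
    then show ?case by (auto simp: c_def bounded_iff)
  qed
  define F where "F = {g. \<exists>xs. \<forall>b\<in>B. g b = c xs b}"
  have F1: "bounded (g ` B)" if g: "g \<in> F" for g
  proof -
    obtain xs where "\<forall>b\<in>B. g b = c xs b" using g by (auto simp: F_def)
    then have "g ` B = c xs ` B" by (intro image_cong) auto
    then show ?thesis using bdd_c by simp
  qed
  have F2: "(\<lambda>_. 0) \<in> F"
    by (auto simp: F_def c_def intro!: exI[of _ "[]"])
  have F3: "(\<lambda>b. g b + h b) \<in> F" if gh: "g \<in> F" "h \<in> F" for g h
  proof -
    obtain xs ys where "\<forall>b\<in>B. g b = c xs b" "\<forall>b\<in>B. h b = c ys b" using gh by (auto simp: F_def)
    then show ?thesis
      by (auto simp: F_def c_def intro!: exI[of _ "xs @ ys"])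
  qed
  \<comment> \<open>As \<open>c xs\<close> is homogeneous of degree p in the vectors, a factor a is
    realised by rescaling all of them by a powr (1 / p).\<close>
  have F4: "(\<lambda>b. a * g b) \<in> F" if a: "0 < a" and g: "g \<in> F" for a g
  proof -
    obtain xs where xs: "\<forall>b\<in>B. g b = c xs b" using g by (auto simp: F_def)
    define r where "r = a powr (1 / p)"
    have r: "0 \<le> r" "r powr p = a"
      using a p by (auto simp: r_def powr_powr)
    have "c (map (\<lambda>x. r *\<^sub>R x) xs) b = a * c xs b" if "b \<in> B" for b
    proof -
      have "b (r *\<^sub>R x) = r *\<^sub>R b x" for x
        using that dual_unit_ball_bounded_linear[of b]
        by (simp add: B_def linear_simps)
      then show ?thesis
        using r by (induction xs) (simp_all add: c_def powr_mult algebra_simps)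
    qed
    then show ?thesis
      using xs by (auto simp: F_def intro!: exI[of _ "map (\<lambda>x. r *\<^sub>R x) xs"])
  qed
  \<comment> \<open>This is where the summing inequality is used: an upper bound m of
    \<open>c xs\<close> on B bounds the weak sums, and summing then forces m \<ge> 0.\<close>
  have F5: "0 \<le> m" if g: "g \<in> F" and m: "\<And>b. b \<in> B \<Longrightarrow> g b \<le> m" for g m
  proof -
    obtain xs where xs: "\<forall>b\<in>B. g b = c xs b" using g by (auto simp: F_def)
    have "(\<Sum>x\<leftarrow>xs. cmod (b x) powr p) \<le> (m + (\<Sum>x\<leftarrow>xs. norm x powr p)) / K'" if "b \<in> B" for b
      using m[OF that] K' xs that
      by (simp add: c_def sum_list_subtractf sum_list_const_mult field_simps)
    from summing[OF this] show ?thesis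
      using K' by simp
  qed
  obtain M :: "(('a \<Rightarrow> complex) \<Rightarrow> real) \<Rightarrow> real" where M:
    "(\<forall>g h. bounded (g ` B) \<longrightarrow> bounded (h ` B) \<longrightarrow> M (\<lambda>b. g b + h b) = M g + M h) \<and>
     (\<forall>c g. bounded (g ` B) \<longrightarrow> M (\<lambda>b. c * g b) = c * M g) \<and>
     (\<forall>g m. bounded (g ` B) \<longrightarrow> (\<forall>b\<in>B. g b \<le> m) \<longrightarrow> M g \<le> m) \<and>
     (\<forall>g\<in>F. 0 \<le> M g)"
    by (rule exE[OF dominated_mean_exists[of F B, OF F1 F2 F3 F4 F5]])
  have M_add: "\<And>g h. bounded (g ` B) \<Longrightarrow> bounded (h ` B) \<Longrightarrow> M (\<lambda>b. g b + h b) = M g + M h"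
    and M_scale: "\<And>a g. bounded (g ` B) \<Longrightarrow> M (\<lambda>b. a * g b) = a * M g"
    and M_le: "\<And>g m. bounded (g ` B) \<Longrightarrow> (\<And>b. b \<in> B \<Longrightarrow> g b \<le> m) \<Longrightarrow> M g \<le> m"
    and M_F: "\<And>g. g \<in> F \<Longrightarrow> 0 \<le> M g"
    using M by simp_all
  \<comment> \<open>Pietsch domination: for a single vector x it says that norm x ^ p is at most K'
    times the mean of |x' x| ^ p.\<close>
  have M_c: "0 \<le> M (c xs)" for xs
    by (rule M_F) (auto simp: F_def)
  define ip where "ip x y = M (\<lambda>x'. Re (x' x * cnj (x' y)))" for x y
  have bdd_ip: "bounded ((\<lambda>x'. Re (x' x * cnj (x' y))) ` B)" for x y
  proof (rule boundedI)
    fix r assume "r \<in> (\<lambda>x'. Re (x' x * cnj (x' y))) ` B"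
    then obtain x' where x': "x' \<in> B" "r = Re (x' x * cnj (x' y))" by auto
    have "\<bar>r\<bar> \<le> cmod (x' x * cnj (x' y))"
      unfolding x' by (rule abs_Re_le_cmod)
    also have "\<dots> \<le> norm x * norm y"
      using le[OF x'(1)] by (simp add: norm_mult mult_mono)
    finally show "norm r \<le> norm x * norm y" by simp
  qed
  \<comment> \<open>M is controlled on B only, by one-sided bounds; applying these to g - h and to h
    - g shows that values off B do not matter.\<close>
  have M_cong: "M g = M h" if "bounded (g ` B)" "bounded (h ` B)" "\<And>b. b \<in> B \<Longrightarrow> g b = h b" for g h
  proof -
    have "bounded ((\<lambda>b. - 1 * h b) ` B)"
      using bounded_scaling[OF that(2), of "-1"] by (simp add: image_image)
    note * = M_add[OF that(1) this] M_scale[OF that(2), of "-1"] bounded_plus_comp[OF that(1) this]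
    have "M (\<lambda>b. g b + - 1 * h b) \<le> 0"
      using *(3) that(3) by (intro M_le) auto
    moreover have "bounded ((\<lambda>b. - 1 * (g b + - 1 * h b)) ` B)"
      using bounded_scaling[OF *(3), of "-1"] by (simp add: image_image)
    then have "M (\<lambda>b. - 1 * (g b + - 1 * h b)) \<le> 0"
      using that(3) by (intro M_le) auto
    ultimately show ?thesis
      using * M_scale[OF *(3), of "-1"] by linarith
  qed
  have lin: "linear (\<lambda>x. ip x y)" for y
  proof (rule linearI)
    fix x z
    have "ip (x + z) y = M (\<lambda>x'. Re (x' x * cnj (x' y)) + Re (x' z * cnj (x' y)))"
      unfolding ip_def
    proof (rule M_cong[OF bdd_ip bounded_plus_comp[OF bdd_ip bdd_ip]])
      fix b assume "b \<in> B"
      then have "b (x + z) = b x + b z"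
        using dual_unit_ball_bounded_linear[of b] by (simp add: B_def linear_simps)
      then show "Re (b (x + z) * cnj (b y)) = Re (b x * cnj (b y)) + Re (b z * cnj (b y))"
        by (simp add: algebra_simps)
    qed
    then show "ip (x + z) y = ip x y + ip z y"
      using M_add[OF bdd_ip bdd_ip] by (simp only: ip_def)
  next
    fix r :: real and x
    have "ip (r *\<^sub>R x) y = M (\<lambda>x'. r * Re (x' x * cnj (x' y)))"
      unfolding ip_def
    proof (rule M_cong[OF bdd_ip])
      show "bounded ((\<lambda>x'. r * Re (x' x * cnj (x' y))) ` B)"
        using bounded_scaling[OF bdd_ip[of x y], of r] by (simp add: image_image)
      fix b assume "b \<in> B"
      then have "b (r *\<^sub>R x) = r *\<^sub>R b x"
        using dual_unit_ball_bounded_linear[of b] by (simp add: B_def linear_simps)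
      then show "Re (b (r *\<^sub>R x) * cnj (b y)) = r * Re (b x * cnj (b y))"
        by (simp add: algebra_simps)
    qed
    then show "ip (r *\<^sub>R x) y = r *\<^sub>R ip x y"
      using M_scale[OF bdd_ip] by (simp only: ip_def real_scaleR_def)
  qed
  have sym: "ip x y = ip y x" for x y
    by (simp add: ip_def mult.commute)
  have ip_self: "ip x x = M (\<lambda>x'. (cmod (x' x))\<^sup>2)" for x
    by (simp add: ip_def complex_mult_cnj cmod_power2)
  have bdd_sq: "bounded ((\<lambda>x'. (cmod (x' x))\<^sup>2) ` B)" for x
    using bdd_ip[of x x] by (simp add: complex_mult_cnj cmod_power2)
  \<comment> \<open>This is \<kappa> ^ (- 2) for the \<kappa> chosen next.\<close>
  define L where "L = (2 * K') powr (2 / p)"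
  have L: "0 < L" using K' by (simp add: L_def)
  have norm: "(norm x)\<^sup>2 \<le> L * ip x x" for x
  proof (cases "x = 0")
    case False
    \<comment> \<open>Chosen so that at the scale s = norm x * \<kappa> the remainder K' * s ^ p is
      exactly half of norm x ^ p.\<close>
    define \<kappa> where "\<kappa> = (2 * K') powr (- 1 / p)"
    have "\<kappa> powr p = (2 * K') powr - 1"
      using p by (simp add: \<kappa>_def powr_powr)
    then have \<kappa>: "0 < \<kappa>" "\<kappa> powr p = 1 / (2 * K')"
      using K' by (simp_all add: \<kappa>_def powr_minus_divide)
    have "L * \<kappa> powr 2 = 1"
      using K' p by (simp add: L_def \<kappa>_def powr_powr flip: powr_add)
    then have L\<kappa>: "L * \<kappa>\<^sup>2 = 1"
      using \<kappa> by simp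
    define s where "s = norm x * \<kappa>"
    have s: "0 < s" using False \<kappa> by (simp add: s_def)
    have sq: "bounded ((\<lambda>x'. K' * s powr (p - 2) * (cmod (x' x))\<^sup>2) ` B)"
      using bounded_scaling[OF bdd_sq[of x], of "K' * s powr (p - 2)"] by (simp add: image_image)
    define d where "d = K' * s powr p - norm x powr p"
    have "M (\<lambda>x'. c [x] x' + - 1 * (K' * s powr (p - 2) * (cmod (x' x))\<^sup>2)) \<le> d"
    proof (rule M_le)
      show "bounded ((\<lambda>x'. c [x] x' + - 1 * (K' * s powr (p - 2) * (cmod (x' x))\<^sup>2)) ` B)"
        using bounded_scaling[OF sq, of "-1"] by (intro bounded_plus_comp bdd_c) (simp add: image_image)
      fix b assume "b \<in> B"
      have "K' * cmod (b x) powr p \<le> K' * (s powr (p - 2) * (cmod (b x))\<^sup>2 + s powr p)"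
        using K' s p by (intro mult_left_mono powr_le_scaled_square) auto
      then show "c [x] b + - 1 * (K' * s powr (p - 2) * (cmod (b x))\<^sup>2) \<le> d"
        by (simp add: c_def d_def algebra_simps)
    qed
    also have "M (\<lambda>x'. c [x] x' + - 1 * (K' * s powr (p - 2) * (cmod (x' x))\<^sup>2))
        = M (c [x]) + M (\<lambda>x'. - 1 * (K' * s powr (p - 2) * (cmod (x' x))\<^sup>2))"
      using bounded_scaling[OF sq, of "-1"] by (intro M_add bdd_c) (simp add: image_image)
    also have "M (\<lambda>x'. - 1 * (K' * s powr (p - 2) * (cmod (x' x))\<^sup>2)) = - (K' * s powr (p - 2) * ip x x)"
      using M_scale[OF sq, of "-1"] M_scale[OF bdd_sq, of "K' * s powr (p - 2)" x] by (simp add: ip_self)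
    finally have "norm x powr p \<le> K' * s powr (p - 2) * ip x x + K' * s powr p"
      using M_c[of "[x]"] by (simp add: d_def)
    also have "K' * s powr p = norm x powr p / 2"
      using K' \<kappa> by (simp add: s_def powr_mult)
    finally have "norm x powr p \<le> 2 * K' * s powr (p - 2) * ip x x"
      by simp
    then have "\<kappa> powr p * norm x powr p \<le> \<kappa> powr p * (2 * K' * s powr (p - 2) * ip x x)"
      by (intro mult_left_mono) auto
    also have "\<kappa> powr p * norm x powr p = s powr (p - 2) * s\<^sup>2"
      using s \<kappa>(1) powr_add[of s "p - 2" 2] by (simp add: s_def powr_mult power_mult_distrib mult.commute)
    also have "\<kappa> powr p * (2 * K' * s powr (p - 2) * ip x x) = s powr (p - 2) * ip x x"
      using K' by (simp add: \<kappa>(2))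
    finally have "s\<^sup>2 \<le> ip x x"
      using s by simp
    then have "L * (norm x * \<kappa>)\<^sup>2 \<le> L * ip x x"
      using L by (simp add: s_def)
    moreover have "L * (norm x * \<kappa>)\<^sup>2 = (norm x)\<^sup>2"
      using L\<kappa> by (simp add: power_mult_distrib mult.left_commute)
    ultimately show ?thesis by simp
  qed (use linear_0[OF lin] in simp)
  define n where "n = nat \<lceil>2 * L\<rceil> + 1"
  have pos: "0 < ip x x" if "x \<noteq> 0" for x
  proof -
    have "0 < L * ip x x"
      using norm[of x] that by (intro less_le_trans[OF _ norm]) simp
    then show ?thesis using L by (simp add: zero_less_mult_iff)
  qed
  obtain e :: "nat \<Rightarrow> 'a" where "\<forall>i<n. \<forall>j<n. ip (e i) (e j) = of_bool (i = j)"
    using orthonormal_exists[OF inf lin sym pos] by blast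
  then have e: "\<And>i j. i < n \<Longrightarrow> j < n \<Longrightarrow> ip (e i) (e j) = of_bool (i = j)"
    by blast
  have sum_M: "bounded ((\<lambda>x'. \<Sum>k<m. (cmod (x' (e k)))\<^sup>2) ` B)
      \<and> M (\<lambda>x'. \<Sum>k<m. (cmod (x' (e k)))\<^sup>2) = (\<Sum>k<m. ip (e k) (e k))" for m
  proof (induction m)
    case 0
    then show ?case
      using M_scale[of "\<lambda>_. 0" 0] by (auto simp: bounded_iff)
  next
    case (Suc m)
    then show ?case
      using M_add[OF conjunct1[OF Suc] bdd_sq[of "e m"]] bounded_plus_comp[OF conjunct1[OF Suc] bdd_sq[of "e m"]]
      by (simp add: ip_self)
  qed
  have "real n = (\<Sum>k<n. ip (e k) (e k))"
    using e by simp
  also have "\<dots> = M (\<lambda>x'. \<Sum>k<n. (cmod (x' (e k)))\<^sup>2)"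
    using sum_M by simp
  also have "\<dots> \<le> 2 * L"
  proof (rule M_le)
    fix x' assume x': "x' \<in> B"
    then have x'_lin: "linear x'"
      by (intro bounded_linear.linear dual_unit_ball_bounded_linear) (simp add: B_def)
    have "(\<Sum>k<n. (Re (x' (e k)))\<^sup>2) \<le> L"
    proof (rule orthonormal_sum_square_le[OF lin sym norm less_imp_le[OF L] e])
      show "linear (\<lambda>x. Re (x' x))"
        by (rule linearI) (simp_all add: linear_add[OF x'_lin] linear_cmul[OF x'_lin])
      show "Re (x' x) \<le> norm x" for x
        using le[OF x', of x] complex_Re_le_cmod[of "x' x"] by linarith
    qed
    moreover have "(\<Sum>k<n. (Im (x' (e k)))\<^sup>2) \<le> L"
    proof (rule orthonormal_sum_square_le[OF lin sym norm less_imp_le[OF L] e])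
      show "linear (\<lambda>x. Im (x' x))"
        by (rule linearI) (simp_all add: linear_add[OF x'_lin] linear_cmul[OF x'_lin])
      show "Im (x' x) \<le> norm x" for x
        using le[OF x', of x] abs_Im_le_cmod[of "x' x"] by linarith
    qed
    ultimately show "(\<Sum>k<n. (cmod (x' (e k)))\<^sup>2) \<le> 2 * L"
      by (simp add: cmod_power2 sum.distrib)
  qed (use sum_M in blast)
  finally show False
    unfolding n_def by linarith
qed

section \<open>Rotations and circle means\<close>

text \<open>Identifies Lebesgue measure on the plane with the product measure, so that Tonelli
  applies to real and imaginary parts.\<close>

lemma distr_Complex_lborel:
  "distr (lborel \<Otimes>\<^sub>M lborel) borel (\<lambda>(x, y). Complex x y) = lborel"
proof (rule lborel_eqI[symmetric])
  fix l u :: complex assume le: "\<And>b. b \<in> Basis \<Longrightarrow> l \<bullet> b \<le> u \<bullet> b"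
  have lu: "Re l \<le> Re u" "Im l \<le> Im u"
    using le[of 1] le[of \<i>] by (auto simp: Basis_complex_def inner_complex_def)
  have meas: "(\<lambda>(x, y). Complex x y) \<in> borel_measurable (lborel \<Otimes>\<^sub>M lborel)"
    by (simp add: Complex_eq case_prod_beta')
  have "(\<lambda>(x, y). Complex x y) -` box l u = {Re l<..<Re u} \<times> {Im l<..<Im u}"
    by (auto simp: box_def Basis_complex_def inner_complex_def)
  then show "emeasure (distr (lborel \<Otimes>\<^sub>M lborel) borel (\<lambda>(x, y). Complex x y)) (box l u)
      = ennreal (\<Prod>b\<in>Basis. (u - l) \<bullet> b)"
    using lu by (simp add: emeasure_distr[OF meas] space_pair_measure lborel.emeasure_pair_measure_Times
        Basis_complex_def inner_complex_def ennreal_mult)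
qed simp

lemma nn_integral_complex:
  fixes g :: "complex \<Rightarrow> ennreal"
  assumes [measurable]: "g \<in> borel_measurable borel"
  shows "(\<integral>\<^sup>+z. g z \<partial>lborel) = (\<integral>\<^sup>+x. \<integral>\<^sup>+y. g (Complex x y) \<partial>lborel \<partial>lborel)"
    and "(\<integral>\<^sup>+z. g z \<partial>lborel) = (\<integral>\<^sup>+y. \<integral>\<^sup>+x. g (Complex x y) \<partial>lborel \<partial>lborel)"
proof -
  have [measurable]: "(\<lambda>(x, y). Complex x y) \<in> borel_measurable (lborel \<Otimes>\<^sub>M lborel)"
    by (simp add: Complex_eq case_prod_beta')
  have [measurable]: "(\<lambda>(x, y). g (Complex x y)) \<in> borel_measurable (lborel \<Otimes>\<^sub>M lborel)"
    by (simp add: Complex_eq case_prod_beta')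
  have eq: "(\<integral>\<^sup>+z. g z \<partial>lborel) = (\<integral>\<^sup>+(x, y). g (Complex x y) \<partial>(lborel \<Otimes>\<^sub>M lborel))"
    by (subst distr_Complex_lborel[symmetric]) (simp add: nn_integral_distr case_prod_beta')
  show "(\<integral>\<^sup>+z. g z \<partial>lborel) = (\<integral>\<^sup>+x. \<integral>\<^sup>+y. g (Complex x y) \<partial>lborel \<partial>lborel)"
    unfolding eq by (subst lborel.nn_integral_fst[symmetric]) simp_all
  show "(\<integral>\<^sup>+z. g z \<partial>lborel) = (\<integral>\<^sup>+y. \<integral>\<^sup>+x. g (Complex x y) \<partial>lborel \<partial>lborel)"
    unfolding eq by (subst lborel_pair.nn_integral_snd[symmetric]) simp_all
qed

lemma nn_integral_lborel_translate:
  fixes g :: "'a::euclidean_space \<Rightarrow> ennreal"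
  assumes [measurable]: "g \<in> borel_measurable borel"
  shows "(\<integral>\<^sup>+z. g (c + z) \<partial>lborel) = (\<integral>\<^sup>+z. g z \<partial>lborel)"
  by (subst (2) lborel_distr_plus[of c, symmetric]) (simp add: nn_integral_distr)

text \<open>At a fixed imaginary part the shear is a translation of the real part.\<close>

lemma nn_integral_complex_shear_Re:
  fixes g :: "complex \<Rightarrow> ennreal" and t :: real
  assumes [measurable]: "g \<in> borel_measurable borel"
  shows "(\<integral>\<^sup>+z. g (z + of_real (t * Im z)) \<partial>lborel) = (\<integral>\<^sup>+z. g z \<partial>lborel)"
proof -
  have "(\<integral>\<^sup>+z. g (z + of_real (t * Im z)) \<partial>lborel) = (\<integral>\<^sup>+y. \<integral>\<^sup>+x. g (Complex (t * y + x) y) \<partial>lborel \<partial>lborel)"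
    by (subst nn_integral_complex(2)) (simp_all add: Complex_eq algebra_simps)
  also have "\<dots> = (\<integral>\<^sup>+y. \<integral>\<^sup>+x. g (Complex x y) \<partial>lborel \<partial>lborel)"
    by (subst nn_integral_lborel_translate) (simp_all add: Complex_eq)
  finally show ?thesis
    by (simp add: nn_integral_complex(2))
qed

lemma nn_integral_complex_shear_Im:
  fixes g :: "complex \<Rightarrow> ennreal" and t :: real
  assumes [measurable]: "g \<in> borel_measurable borel"
  shows "(\<integral>\<^sup>+z. g (z + \<i> * of_real (t * Re z)) \<partial>lborel) = (\<integral>\<^sup>+z. g z \<partial>lborel)"
proof -
  have "(\<integral>\<^sup>+z. g (z + \<i> * of_real (t * Re z)) \<partial>lborel) = (\<integral>\<^sup>+x. \<integral>\<^sup>+y. g (Complex x (t * x + y)) \<partial>lborel \<partial>lborel)"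
    by (subst nn_integral_complex(1)) (simp_all add: Complex_eq algebra_simps)
  also have "\<dots> = (\<integral>\<^sup>+x. \<integral>\<^sup>+y. g (Complex x y) \<partial>lborel \<partial>lborel)"
    by (subst nn_integral_lborel_translate) (simp_all add: Complex_eq)
  finally show ?thesis
    by (simp add: nn_integral_complex(1))
qed

text \<open>A rotation other than \<open>z \<mapsto> - z\<close> is a product of three shears.\<close>

lemma nn_integral_complex_rotate:
  fixes g :: "complex \<Rightarrow> ennreal"
  assumes g[measurable]: "g \<in> borel_measurable borel" and c: "cmod c = 1"
  shows "(\<integral>\<^sup>+z. g (c * z) \<partial>lborel) = (\<integral>\<^sup>+z. g z \<partial>lborel)"
proof -
  have *: "(\<integral>\<^sup>+z. g (c * z) \<partial>lborel) = (\<integral>\<^sup>+z. g z \<partial>lborel)"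
    if [measurable]: "g \<in> borel_measurable borel" and c: "cmod c = 1" "c \<noteq> - 1" for g :: "complex \<Rightarrow> ennreal" and c
  proof -
    \<comment> \<open>For c = exp (i \<theta>) this is - tan (\<theta> / 2), and T below shears by
      sin \<theta>; the tangent is infinite exactly at c = - 1.\<close>
    define \<tau> where "\<tau> = - Im c / (1 + Re c)"
    define S where "S z = z + of_real (\<tau> * Im z)" for z
    define T where "T z = z + \<i> * of_real (Im c * Re z)" for z
    have [measurable]: "S \<in> borel_measurable borel" "T \<in> borel_measurable borel"
      unfolding S_def T_def by measurable
    have sq: "(Re c)\<^sup>2 + (Im c)\<^sup>2 = 1"
      using c(1) by (simp flip: cmod_power2)
    have "1 + Re c \<noteq> 0"
    proof
      assume "1 + Re c = 0"
      then have "Re c = - 1" by simp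
      moreover from this have "Im c = 0" using sq by simp
      ultimately show False using c(2) by (simp add: complex_eq_iff)
    qed
    then have \<tau>: "\<tau> * (1 + Re c) = - Im c"
      by (simp add: \<tau>_def)
    have "(1 + Re c) * (1 + \<tau> * Im c) = (1 + Re c) * Re c"
    proof -
      have "(1 + Re c) * (1 + \<tau> * Im c) = 1 + Re c + (\<tau> * (1 + Re c)) * Im c"
        by (simp add: algebra_simps)
      also have "\<dots> = (1 + Re c) * Re c"
        unfolding \<tau> using sq by (simp add: algebra_simps power2_eq_square)
      finally show ?thesis .
    qed
    then have \<tau>2: "1 + \<tau> * Im c = Re c"
      using \<open>1 + Re c \<noteq> 0\<close> by simp
    have "c * z = S (T (S z))" for z
    proof (rule complex_eqI)
      have "Re (S (T (S z))) = (1 + \<tau> * Im c) * Re z + \<tau> * (1 + (1 + \<tau> * Im c)) * Im z"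
        by (simp add: S_def T_def algebra_simps)
      then show "Re (c * z) = Re (S (T (S z)))"
        unfolding \<tau>2 \<tau> by simp
      have "Im (S (T (S z))) = Im c * Re z + (1 + \<tau> * Im c) * Im z"
        by (simp add: S_def T_def algebra_simps)
      then show "Im (c * z) = Im (S (T (S z)))"
        unfolding \<tau>2 by simp
    qed
    then have "(\<integral>\<^sup>+z. g (c * z) \<partial>lborel) = (\<integral>\<^sup>+z. (\<lambda>w. g (S (T w))) (S z) \<partial>lborel)"
      by simp
    also have "\<dots> = (\<integral>\<^sup>+z. (\<lambda>w. g (S w)) (T z) \<partial>lborel)"
      unfolding S_def[of "_::complex"]
      using nn_integral_complex_shear_Re[of "\<lambda>w. g (S (T w))" \<tau>] by (simp add: S_def)
    also have "\<dots> = (\<integral>\<^sup>+z. g (S z) \<partial>lborel)"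
      using nn_integral_complex_shear_Im[of "\<lambda>w. g (S w)" "Im c"] by (simp add: T_def)
    also have "\<dots> = (\<integral>\<^sup>+z. g z \<partial>lborel)"
      using nn_integral_complex_shear_Re[of g \<tau>] by (simp add: S_def)
    finally show ?thesis .
  qed
  show ?thesis
  \<comment> \<open>The half turn is two quarter turns, each covered by the shear argument.\<close>
  proof (cases "c = - 1")
    case True
    have "\<i> \<noteq> - 1" by (simp add: complex_eq_iff)
    then show ?thesis
      using *[of "\<lambda>z. g (\<i> * z)" \<i>] *[of g \<i>] True by (simp flip: mult.assoc)
  qed (use * g c in blast)
qed

text \<open>The tangent form of convexity, obtained from Young's inequality for t and s ^ (p - 1)
  with exponents p and p / (p - 1), which includes s = 0 without any differentiation.\<close>

lemma powr_ge_tangent: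
  fixes s t p :: real
  assumes "1 < p" "0 \<le> s" "0 \<le> t"
  shows "s powr p + p * s powr (p - 1) * (t - s) \<le> t powr p"
proof -
  have "t * s powr (p - 1) \<le> t powr p / p + (s powr (p - 1)) powr (p / (p - 1)) / (p / (p - 1))"
    using assms by (intro Youngs_inequality) (auto simp: field_simps)
  also have "(s powr (p - 1)) powr (p / (p - 1)) = s powr p"
    using assms by (simp add: powr_powr)
  finally have "p * (t * s powr (p - 1)) \<le> p * (t powr p / p + s powr p / (p / (p - 1)))"
    using assms by (intro mult_left_mono) auto
  also have "\<dots> = t powr p + (p - 1) * s powr p"
    using assms by (simp add: field_simps)
  finally have "p * (t * s powr (p - 1)) \<le> t powr p + p * s powr p - s powr p"
    by (simp add: left_diff_distrib)
  moreover have "s powr (p - 1) * s = s powr p"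
    using assms powr_mult_base[of s "p - 1"] by (simp add: mult.commute)
  then have "p * s powr (p - 1) * (t - s) = p * (t * s powr (p - 1)) - p * s powr p"
    by (simp add: algebra_simps)
  ultimately show ?thesis
    by linarith
qed

text \<open>Cauchy's formula gives the mean value property; Jensen's inequality is then the tangent
  at s = |H 0| integrated over the circle.\<close>

lemma circle_mean_powr:
  fixes H :: "complex \<Rightarrow> complex"
  assumes H: "H holomorphic_on UNIV" and p: "1 < p"
  shows "ennreal (cmod (H 0) powr p)
      \<le> (\<integral>\<^sup>+t. ennreal (cmod (H (exp (2 * of_real pi * \<i> * of_real t))) powr p) * indicator {0..1} t \<partial>lborel)"
proof -
  define e where "e t = exp (2 * of_real pi * \<i> * complex_of_real t)" for t
  have cont_e: "continuous_on A e" for A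
    unfolding e_def by (intro continuous_intros)
  have cont_H: "continuous_on {0..1} (\<lambda>t. H (e t))"
    using continuous_on_compose2[OF holomorphic_on_imp_continuous_on[OF H] cont_e] by auto
  have "((\<lambda>u. H u / (u - 0)) has_contour_integral (2 * of_real pi * \<i> * H 0)) (circlepath 0 1)"
    by (rule Cauchy_integral_circlepath_simple) (use H holomorphic_on_subset in auto)
  \<comment> \<open>On the unit circle the division by u cancels against the derivative of the
    path.\<close>
  then have "((\<lambda>t. 2 * of_real pi * \<i> * H (e t)) has_integral (2 * of_real pi * \<i> * H 0)) {0..1}"
    unfolding has_contour_integral_def
    by (rule has_integral_eq_rhs[OF has_integral_eq, rotated])
      (simp_all add: vector_derivative_circlepath01, simp add: circlepath e_def)
  then have "((\<lambda>t. H (e t)) has_integral H 0) {0..1}"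
    using has_integral_mult_right[of _ _ "{0..1}" "1 / (2 * of_real pi * \<i>)"] by fastforce
  then have mean: "integral {0..1} (\<lambda>t. H (e t)) = H 0"
    by (rule integral_unique)
  define s where "s = cmod (H 0)"
  define q where "q t = cmod (H (e t))" for t
  have q0: "0 \<le> q t" for t
    by (simp add: q_def)
  have cont_q: "continuous_on {0..1} q"
    unfolding q_def by (intro continuous_intros cont_H)
  have int_q: "q integrable_on {0..1}"
    by (rule integrable_continuous_real[OF cont_q])
  have int_qp: "(\<lambda>t. q t powr p) integrable_on {0..1}"
    by (intro integrable_continuous_real continuous_on_powr' cont_q continuous_on_const) (use p in \<open>auto simp: q_def\<close>)
  have "s \<le> integral {0..1} q"
    unfolding s_def mean[symmetric]
    by (rule integral_norm_bound_integral[OF integrable_continuous_real[OF cont_H] int_q]) (simp add: q_def)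
  \<comment> \<open>The linear term may be added because s is at most the mean of q and the slope is
    nonnegative.\<close>
  have "s powr p \<le> s powr p + p * s powr (p - 1) * (integral {0..1} q - s)"
    using \<open>s \<le> _\<close> p by simp
  also have "\<dots> = integral {0..1} (\<lambda>t. s powr p + p * s powr (p - 1) * (q t - s))"
    using has_integral_add[OF has_integral_const_real[of "s powr p" 0 1] has_integral_mult_right[OF
        has_integral_diff[OF integrable_integral[OF int_q] has_integral_const_real[of s 0 1]],
        of "p * s powr (p - 1)"]]
    by (intro integral_unique[symmetric]) simp
  also have "\<dots> \<le> integral {0..1} (\<lambda>t. q t powr p)"
    by (rule integral_le) (use int_q int_qp p q0 in \<open>auto intro!: integrable_add integrable_on_mult_right integrable_diff powr_ge_tangent simp: s_def\<close>)
  finally have "ennreal (s powr p) \<le> ennreal (integral {0..1} (\<lambda>t. q t powr p))"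
    by (rule ennreal_leI)
  also have "\<dots> = (\<integral>\<^sup>+t. ennreal (q t powr p) * indicator {0..1} t \<partial>lborel)"
    using int_qp by (intro nn_integral_has_integral_lebesgue'[symmetric]) auto
  finally show ?thesis
    by (simp add: s_def q_def e_def)
qed

section \<open>Gaussian weights and the pointwise estimate\<close>

lemma nn_integral_gauss_finite:
  assumes c: "0 < c"
  shows "(\<integral>\<^sup>+z. ennreal (exp (- c * (cmod z)\<^sup>2)) \<partial>lborel) < \<infinity>"
proof -
  define \<sigma> where "\<sigma> = sqrt (1 / (2 * c))"
  have \<sigma>: "0 < \<sigma>" "2 * \<sigma>\<^sup>2 = 1 / c"
    using c by (auto simp: \<sigma>_def)
  define k where "k = sqrt (2 * pi * \<sigma>\<^sup>2)"
  have k: "0 < k"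
    using \<sigma> by (simp add: k_def)
  have gauss: "exp (- c * x\<^sup>2) = k * normal_density 0 \<sigma> x" for x
  proof -
    have "x\<^sup>2 / (2 * \<sigma>\<^sup>2) = c * x\<^sup>2"
      unfolding \<sigma>(2) using c by simp
    then show ?thesis
      using k by (simp add: normal_density_def k_def[symmetric] del: real_sqrt_mult)
  qed
  have fin: "(\<integral>\<^sup>+x. ennreal (exp (- c * x\<^sup>2)) \<partial>lborel) < \<infinity>"
    unfolding gauss using \<sigma> k
    by (subst nn_integral_eq_integral) (auto intro!: integrable_mult_right integrable_normal_density)
  have "(\<integral>\<^sup>+z. ennreal (exp (- c * (cmod z)\<^sup>2)) \<partial>lborel)
      = (\<integral>\<^sup>+x. \<integral>\<^sup>+y. ennreal (exp (- c * x\<^sup>2)) * ennreal (exp (- c * y\<^sup>2)) \<partial>lborel \<partial>lborel)"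
    by (subst nn_integral_complex(1))
      (simp_all add: cmod_power2 algebra_simps exp_diff exp_minus divide_inverse flip: ennreal_mult)
  also have "\<dots> = (\<integral>\<^sup>+x. ennreal (exp (- c * x\<^sup>2)) \<partial>lborel) * (\<integral>\<^sup>+y. ennreal (exp (- c * y\<^sup>2)) \<partial>lborel)"
    by (simp add: nn_integral_cmult nn_integral_multc)
  also have "\<dots> < \<infinity>"
    using fin by (simp add: ennreal_mult_less_top)
  finally show ?thesis .
qed

lemma nn_integral_pos:
  fixes g :: "'a::euclidean_space \<Rightarrow> real"
  assumes [measurable]: "g \<in> borel_measurable borel" and A: "open A" "A \<noteq> {}" and pos: "\<And>x. x \<in> A \<Longrightarrow> 0 < g x"
  shows "0 < (\<integral>\<^sup>+x. ennreal (g x) * indicator A x \<partial>lborel)"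
proof -
  have [measurable]: "A \<in> sets borel" using A by simp
  have "(\<integral>\<^sup>+x. ennreal (g x) * indicator A x \<partial>lborel) \<noteq> 0"
  proof
    assume "(\<integral>\<^sup>+x. ennreal (g x) * indicator A x \<partial>lborel) = 0"
    then have "AE x in lborel. ennreal (g x) * indicator A x = 0"
      by (subst (asm) nn_integral_0_iff_AE) auto
    then have "AE x in lborel. x \<notin> A"
      by eventually_elim (use pos in \<open>force simp: indicator_def split: if_splits\<close>)
    then have "A \<in> null_sets lborel"
      by (simp add: AE_iff_null_sets)
    then show False
      using A open_not_negligible[of A] by (auto simp: negligible_iff_null_sets null_sets_completionI)
  qed
  then show ?thesis
    by (simp add: zero_less_iff_neq_zero)
qed

text \<open>The exponent p is kept out of the weight: the Fock integrand becomes the p-th power of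
  |f| times \<open>gweight\<close>, and translation formulas are independent of p.\<close>

definition gweight :: "real \<Rightarrow> complex \<Rightarrow> real" where
  "gweight \<alpha> z = exp (- (\<alpha> / 2) * (cmod z)\<^sup>2)"

lemma gweight_pos [simp]: "0 < gweight \<alpha> z" "0 \<le> gweight \<alpha> z" "gweight \<alpha> z \<noteq> 0"
  by (simp_all add: gweight_def)

lemma gweight_measurable [measurable]: "gweight \<alpha> \<in> borel_measurable borel"
  unfolding gweight_def by measurable

text \<open>The cross term is the modulus of an exponential that is entire in v, so it can be
  absorbed into a holomorphic function.\<close>

lemma gweight_add:
  "gweight \<alpha> (w + v) = gweight \<alpha> w * gweight \<alpha> v * exp (- \<alpha> * Re (cnj w * v))"
proof -
  have "(cmod (w + v))\<^sup>2 = (cmod w)\<^sup>2 + (cmod v)\<^sup>2 + 2 * Re (cnj w * v)"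
    unfolding cmod_power2 by (simp add: power2_eq_square algebra_simps)
  then show ?thesis
    by (simp add: gweight_def algebra_simps flip: exp_add)
qed

lemma gweight_powr: "gweight \<alpha> z powr p = exp (- (p * \<alpha> / 2) * (cmod z)\<^sup>2)"
  by (simp add: gweight_def powr_def)

lemma fock_integrand: "norm (f z) powr p * exp (- (p * \<alpha> / 2) * (cmod z)\<^sup>2) = (norm (f z) * gweight \<alpha> z) powr p"
  by (simp add: powr_mult gweight_powr)

definition gauss_mass :: "real \<Rightarrow> real \<Rightarrow> ennreal" where
  "gauss_mass p \<alpha> = (\<integral>\<^sup>+z. ennreal (gweight \<alpha> z powr p) \<partial>lborel)"

lemma gauss_mass_finite: "0 < p \<Longrightarrow> 0 < \<alpha> \<Longrightarrow> gauss_mass p \<alpha> < \<infinity>"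
  using nn_integral_gauss_finite[of "p * \<alpha> / 2"]
  by (simp add: gauss_mass_def gweight_powr)

lemma gauss_mass_pos: "0 < gauss_mass p \<alpha>"
  using nn_integral_pos[of "\<lambda>z. gweight \<alpha> z powr p" UNIV] by (simp add: gauss_mass_def)

text \<open>The circle mean property is averaged against the rotation invariant Gaussian weight, after
  multiplying the translate of \<open>h\<close> by the exponential that recentres the weight at \<open>w\<close>.\<close>

lemma fock_pointwise:
  assumes h: "h holomorphic_on UNIV" and p: "1 < p"
  shows "ennreal ((cmod (h w) * gweight \<alpha> w) powr p) * gauss_mass p \<alpha>
      \<le> (\<integral>\<^sup>+z. ennreal ((cmod (h z) * gweight \<alpha> z) powr p) \<partial>lborel)"
proof -
  \<comment> \<open>The modulus of the exponential factor is precisely the cross term of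
    \<open>gweight_add\<close>.\<close>
  define H where "H v = h (w + v) * exp (- \<alpha> * (cnj w * v))" for v
  define e where "e t = exp (2 * of_real pi * \<i> * complex_of_real t)" for t
  have cont_h: "continuous_on A h" for A
    using holomorphic_on_imp_continuous_on[OF h] continuous_on_subset by blast
  have H_hol: "H holomorphic_on UNIV"
    unfolding H_def by (intro holomorphic_intros holomorphic_on_compose_gen[OF _ h, unfolded o_def]) auto
  have [measurable]: "h \<in> borel_measurable borel" "H \<in> borel_measurable borel" "e \<in> borel_measurable borel"
    using cont_h holomorphic_on_imp_continuous_on[OF H_hol]
    by (auto intro!: borel_measurable_continuous_onI continuous_intros simp: e_def[abs_def])
  have e1: "cmod (e t) = 1" for t
    by (simp add: e_def)
  have HG: "cmod (H v) * gweight \<alpha> v * gweight \<alpha> w = cmod (h (w + v)) * gweight \<alpha> (w + v)" for v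
    by (simp add: H_def norm_mult gweight_add)
  define J where "J = (\<integral>\<^sup>+v. ennreal ((cmod (H v) * gweight \<alpha> v) powr p) \<partial>lborel)"
  have "ennreal (cmod (H 0) powr p) * gauss_mass p \<alpha>
      = (\<integral>\<^sup>+v. ennreal (gweight \<alpha> v powr p) * ennreal (cmod (H 0) powr p) \<partial>lborel)"
    unfolding gauss_mass_def by (subst nn_integral_multc) (simp_all add: mult.commute)
  \<comment> \<open>For each v the mean is taken of u -> H (u v), over the circle about 0 through v.
    After Fubini every rotation \<open>e t\<close> disappears and the same integral J remains for
    each t.\<close>
  also have "\<dots> \<le> (\<integral>\<^sup>+v. ennreal (gweight \<alpha> v powr p) *
      (\<integral>\<^sup>+t. ennreal (cmod (H (e t * v)) powr p) * indicator {0..1} t \<partial>lborel) \<partial>lborel)"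
  proof (intro nn_integral_mono mult_left_mono)
    fix v
    have "(\<lambda>u. H (u * v)) holomorphic_on UNIV"
      by (intro holomorphic_on_compose_gen[OF _ H_hol, unfolded o_def] holomorphic_intros) auto
    from circle_mean_powr[OF this p] show "ennreal (cmod (H 0) powr p)
        \<le> (\<integral>\<^sup>+t. ennreal (cmod (H (e t * v)) powr p) * indicator {0..1} t \<partial>lborel)"
      by (simp add: e_def)
  qed simp
  also have "\<dots> = (\<integral>\<^sup>+v. \<integral>\<^sup>+t. ennreal ((cmod (H (e t * v)) * gweight \<alpha> (e t * v)) powr p) * indicator {0..1} t \<partial>lborel \<partial>lborel)"
    by (subst nn_integral_cmult[symmetric])
      (simp_all add: gweight_def norm_mult e1 powr_mult ennreal_mult mult_ac)
  also have "\<dots> = (\<integral>\<^sup>+t. \<integral>\<^sup>+v. ennreal ((cmod (H (e t * v)) * gweight \<alpha> (e t * v)) powr p) * indicator {0..1} t \<partial>lborel \<partial>lborel)"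
    by (rule lborel_pair.Fubini') measurable
  also have "\<dots> = (\<integral>\<^sup>+t. J * indicator {0..1} (t :: real) \<partial>lborel)"
  proof (intro nn_integral_cong)
    fix t :: real
    show "(\<integral>\<^sup>+v. ennreal ((cmod (H (e t * v)) * gweight \<alpha> (e t * v)) powr p) * indicator {0..1} t \<partial>lborel)
        = J * indicator {0..1} t"
      using nn_integral_complex_rotate[of "\<lambda>v. ennreal ((cmod (H v) * gweight \<alpha> v) powr p)", OF _ e1[of t]]
      by (simp add: nn_integral_multc J_def)
  qed
  also have "\<dots> = J"
    by (simp add: nn_integral_cmult)
  finally have "ennreal (cmod (H 0) powr p) * gauss_mass p \<alpha> * ennreal (gweight \<alpha> w powr p) \<le> J * ennreal (gweight \<alpha> w powr p)"
    by (rule mult_right_mono) simp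
  moreover have "J * ennreal (gweight \<alpha> w powr p) = (\<integral>\<^sup>+v. ennreal ((cmod (h (w + v)) * gweight \<alpha> (w + v)) powr p) \<partial>lborel)"
    unfolding J_def HG[symmetric]
    by (subst nn_integral_multc[symmetric]) (simp_all add: powr_mult ennreal_mult)
  moreover have "\<dots> = (\<integral>\<^sup>+z. ennreal ((cmod (h z) * gweight \<alpha> z) powr p) \<partial>lborel)"
    by (rule nn_integral_lborel_translate) measurable
  moreover have "ennreal (cmod (H 0) powr p) * gauss_mass p \<alpha> * ennreal (gweight \<alpha> w powr p)
      = ennreal ((cmod (h w) * gweight \<alpha> w) powr p) * gauss_mass p \<alpha>"
    by (simp add: H_def powr_mult ennreal_mult mult_ac)
  ultimately show ?thesis
    by simp
qed

section \<open>Vector-valued entire functions and Fock norms\<close>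

lemma bounded_linear_scaleC_left: "bounded_linear (\<lambda>c. c *\<^sub>C x)" for x :: "'a::complex_banach"
proof (rule bounded_linear_intro[where K = "norm x"])
  show "(r *\<^sub>R c) *\<^sub>C x = r *\<^sub>R c *\<^sub>C x" for r c
    by (simp add: scaleR_conv_of_real scaleC_scaleC flip: scaleC_of_real)
qed (simp_all add: scaleC_add_left norm_scaleC)

lemma entire_continuous_on: "entire f \<Longrightarrow> continuous_on A f"
  unfolding entire_def continuous_on_eq_continuous_within
  by (metis continuous_at_imp_continuous_within has_derivative_continuous)

lemma entire_norm_measurable:
  assumes "entire f"
  shows "(\<lambda>z. norm (f z)) \<in> borel_measurable borel"
  using assms by (intro borel_measurable_continuous_onI continuous_on_norm entire_continuous_on)

lemma entire_add:
  assumes "entire f" "entire g"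
  shows "entire (\<lambda>z. f z + g z)"
  unfolding entire_def
proof
  fix z
  obtain D E where "(f has_derivative (\<lambda>h. h *\<^sub>C D)) (at z)" "(g has_derivative (\<lambda>h. h *\<^sub>C E)) (at z)"
    using assms unfolding entire_def by meson
  then have "((\<lambda>z. f z + g z) has_derivative (\<lambda>h. h *\<^sub>C (D + E))) (at z)"
    by (simp add: has_derivative_add scaleC_add_right)
  then show "\<exists>D. ((\<lambda>z. f z + g z) has_derivative (\<lambda>h. h *\<^sub>C D)) (at z)"
    by blast
qed

lemma entire_scaleC:
  fixes x :: "'a::complex_banach"
  assumes "g holomorphic_on UNIV"
  shows "entire (\<lambda>z. g z *\<^sub>C x)"
  unfolding entire_def
proof
  fix z
  obtain g' where "(g has_derivative (*) g') (at z)"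
    using assms unfolding holomorphic_on_def field_differentiable_def has_field_derivative_def by auto
  from bounded_linear.has_derivative[OF bounded_linear_scaleC_left this, of x]
  have "((\<lambda>z. g z *\<^sub>C x) has_derivative (\<lambda>h. h *\<^sub>C (g' *\<^sub>C x))) (at z)"
    by (simp add: scaleC_scaleC mult.commute)
  then show "\<exists>D. ((\<lambda>z. g z *\<^sub>C x) has_derivative (\<lambda>h. h *\<^sub>C D)) (at z)"
    by blast
qed

lemma entire_sum_scaleC:
  fixes x :: "nat \<Rightarrow> 'a::complex_banach"
  assumes "\<And>k. g k holomorphic_on UNIV"
  shows "entire (\<lambda>z. \<Sum>k<n. g k z *\<^sub>C x k)"
proof (induction n)
  case 0
  have "((\<lambda>z. 0) has_derivative (\<lambda>h. h *\<^sub>C (0::'a))) (at z)" for z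
    using norm_scaleC[of _ "0::'a"] by simp
  then show ?case
    by (auto simp: entire_def)
next
  case (Suc n)
  then show ?case
    using entire_add[OF Suc entire_scaleC[OF assms]] by simp
qed

lemma entire_comp_affine:
  assumes "entire f"
  shows "entire (\<lambda>z. f (a * z + b))"
  unfolding entire_def
proof
  fix z
  obtain D where D: "(f has_derivative (\<lambda>h. h *\<^sub>C D)) (at (a * z + b))"
    using assms unfolding entire_def by meson
  have "((\<lambda>z. a * z + b) has_derivative (\<lambda>h. a * h)) (at z)"
    by (auto intro!: derivative_eq_intros)
  from has_derivative_compose[OF this D]
  have "((\<lambda>z. f (a * z + b)) has_derivative (\<lambda>h. h *\<^sub>C (a *\<^sub>C D))) (at z)"
    by (simp add: scaleC_scaleC mult.commute)
  then show "\<exists>D. ((\<lambda>z. f (a * z + b)) has_derivative (\<lambda>h. h *\<^sub>C D)) (at z)"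
    by blast
qed

lemma entire_dual:
  assumes "entire f" and x': "x' \<in> dual_unit_ball"
  shows "(x' \<circ> f) holomorphic_on UNIV"
  unfolding entire_complex_iff[symmetric] entire_def
proof
  fix z
  obtain D where "(f has_derivative (\<lambda>h. h *\<^sub>C D)) (at z)"
    using assms unfolding entire_def by meson
  from bounded_linear.has_derivative[OF dual_unit_ball_bounded_linear[OF x'] this]
  have "((x' \<circ> f) has_derivative (\<lambda>h. h *\<^sub>C x' D)) (at z)"
    by (simp add: o_def dual_unit_ball_scaleC[OF x'] scaleC_complex_def)
  then show "\<exists>D. ((x' \<circ> f) has_derivative (\<lambda>h. h *\<^sub>C D)) (at z)"
    by blast
qed

lemma fock_space_iff:
  "f \<in> fock_space p \<alpha> \<longleftrightarrow> entire f \<and> (\<integral>\<^sup>+z. ennreal ((norm (f z) * gweight \<alpha> z) powr p) \<partial>lborel) < \<infinity>"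
  unfolding fock_space_def fock_integrand by simp

lemma fock_norm_nonneg: "0 \<le> fock_norm p \<alpha> f"
  by (simp add: fock_norm_def)

lemma fock_norm_powr:
  assumes f: "f \<in> fock_space p \<alpha>" and p: "0 < p"
  shows "ennreal (fock_norm p \<alpha> f powr p) = (\<integral>\<^sup>+z. ennreal ((norm (f z) * gweight \<alpha> z) powr p) \<partial>lborel)"
proof -
  have [measurable]: "(\<lambda>z. norm (f z)) \<in> borel_measurable borel"
    using f by (intro entire_norm_measurable) (simp add: fock_space_iff)
  have "fock_norm p \<alpha> f powr p = (LINT z|lborel. (norm (f z) * gweight \<alpha> z) powr p)"
    unfolding fock_norm_def fock_integrand using p by (simp add: powr_powr)
  also have "\<dots> = enn2real (\<integral>\<^sup>+z. ennreal ((norm (f z) * gweight \<alpha> z) powr p) \<partial>lborel)"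
    by (rule integral_eq_nn_integral) auto
  finally show ?thesis
    using f by (simp add: fock_space_iff)
qed

lemma fock_spaceI:
  assumes f: "entire f" and p: "0 < p" and Q: "0 \<le> Q"
    and le: "(\<integral>\<^sup>+z. ennreal ((norm (f z) * gweight \<alpha> z) powr p) \<partial>lborel) \<le> ennreal Q"
  shows "f \<in> fock_space p \<alpha>" "fock_norm p \<alpha> f \<le> Q powr (1 / p)"
proof -
  have "(\<integral>\<^sup>+z. ennreal ((norm (f z) * gweight \<alpha> z) powr p) \<partial>lborel) < \<infinity>"
    using le by (simp add: order_le_less_trans[OF le])
  then show *: "f \<in> fock_space p \<alpha>"
    using f by (simp add: fock_space_iff)
  have "fock_norm p \<alpha> f powr p \<le> Q"
    using le Q unfolding fock_norm_powr[OF * p, symmetric] by simp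
  then have "(fock_norm p \<alpha> f powr p) powr (1 / p) \<le> Q powr (1 / p)"
    using p by (intro powr_mono2) auto
  then show "fock_norm p \<alpha> f \<le> Q powr (1 / p)"
    using p by (simp add: powr_powr fock_norm_nonneg)
qed

lemma weak_fock_spaceI:
  fixes f :: "complex \<Rightarrow> 'a::complex_banach"
  assumes f: "entire f" and p: "0 < p" and Q: "0 \<le> Q"
    and le: "\<And>x'. x' \<in> dual_unit_ball \<Longrightarrow>
      (\<integral>\<^sup>+z. ennreal ((cmod (x' (f z)) * gweight \<alpha> z) powr p) \<partial>lborel) \<le> ennreal Q"
  shows "f \<in> weak_fock_space p \<alpha>" "weak_fock_norm p \<alpha> f \<le> Q powr (1 / p)"
proof -
  have *: "x' \<circ> f \<in> fock_space p \<alpha>" "fock_norm p \<alpha> (x' \<circ> f) \<le> Q powr (1 / p)"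
    if "x' \<in> dual_unit_ball" for x'
    using fock_spaceI[OF _ p Q, of "x' \<circ> f" \<alpha>] le[OF that] entire_dual[OF f that]
    by (simp_all add: entire_complex_iff)
  show "f \<in> weak_fock_space p \<alpha>"
    using f * by (auto simp: weak_fock_space_def bdd_above_def)
  show "weak_fock_norm p \<alpha> f \<le> Q powr (1 / p)"
    unfolding weak_fock_norm_def using zero_in_dual_unit_ball * by (intro cSUP_least) auto
qed

lemma weak_fock_norm_upper:
  "f \<in> weak_fock_space p \<alpha> \<Longrightarrow> x' \<in> dual_unit_ball \<Longrightarrow> fock_norm p \<alpha> (x' \<circ> f) \<le> weak_fock_norm p \<alpha> f"
  unfolding weak_fock_norm_def weak_fock_space_def by (auto intro!: cSUP_upper)

text \<open>A functional norming the single vector f w reduces the estimate to the scalar function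
  x' o f, whose norm is at most the weak norm.\<close>

lemma weak_fock_pointwise:
  fixes f :: "complex \<Rightarrow> 'a::complex_banach"
  assumes f: "f \<in> weak_fock_space p \<alpha>" and p: "1 < p"
  shows "ennreal ((norm (f w) * gweight \<alpha> w) powr p) * gauss_mass p \<alpha> \<le> ennreal (weak_fock_norm p \<alpha> f powr p)"
proof -
  obtain x' where x': "x' \<in> dual_unit_ball" "cmod (x' (f w)) = norm (f w)"
    using norming_functional by blast
  have ent: "entire f" and mem: "x' \<circ> f \<in> fock_space p \<alpha>"
    using f x' by (auto simp: weak_fock_space_def)
  have "ennreal ((norm (f w) * gweight \<alpha> w) powr p) * gauss_mass p \<alpha> \<le> ennreal (fock_norm p \<alpha> (x' \<circ> f) powr p)"
    using fock_pointwise[OF entire_dual[OF ent x'(1)] p, of w \<alpha>] fock_norm_powr[OF mem] p x' by simp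
  also have "\<dots> \<le> ennreal (weak_fock_norm p \<alpha> f powr p)"
    using weak_fock_norm_upper[OF f x'(1)] p by (intro ennreal_leI powr_mono2) (auto simp: fock_norm_nonneg)
  finally show ?thesis .
qed

section \<open>Sufficiency: contractive affine symbols\<close>

text \<open>Convexity of the square at t and s / (1 - r) with weights r and 1 - r.\<close>

lemma convex_square_bound:
  fixes r s t :: real
  assumes "0 \<le> r" "r < 1"
  shows "(r * t + s)\<^sup>2 \<le> r * t\<^sup>2 + s\<^sup>2 / (1 - r)"
proof -
  have "r * t\<^sup>2 + s\<^sup>2 / (1 - r) - (r * t + s)\<^sup>2 = r / (1 - r) * ((1 - r) * t - s)\<^sup>2"
    using assms by (simp add: divide_simps) (simp add: power2_eq_square algebra_simps)
  moreover have "0 \<le> r / (1 - r) * ((1 - r) * t - s)\<^sup>2"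
    using assms by simp
  ultimately show ?thesis by linarith
qed

text \<open>By |a z + b| ^ 2 \<le> |a| |z| ^ 2 + M, passing from z to a z + b leaves over a Gaussian
  of rate \<alpha> (1 - |a|), which is integrable when |a| < 1.\<close>

lemma gweight_affine:
  assumes a: "cmod a < 1" and \<alpha>: "0 < \<alpha>"
  shows "gweight \<alpha> z \<le> gweight \<alpha> (a * z + b) * (exp (\<alpha> / 2 * ((cmod b)\<^sup>2 / (1 - cmod a))) * gweight (\<alpha> * (1 - cmod a)) z)"
proof -
  define M where "M = (cmod b)\<^sup>2 / (1 - cmod a)"
  have "cmod (a * z + b) \<le> cmod a * cmod z + cmod b"
    using norm_triangle_ineq[of "a * z" b] by (simp add: norm_mult)
  then have "(cmod (a * z + b))\<^sup>2 \<le> (cmod a * cmod z + cmod b)\<^sup>2"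
    by (intro power_mono) auto
  also have "\<dots> \<le> cmod a * (cmod z)\<^sup>2 + M"
    unfolding M_def using a by (intro convex_square_bound) auto
  finally have "(\<alpha> / 2) * (cmod (a * z + b))\<^sup>2 \<le> (\<alpha> / 2) * (cmod a * (cmod z)\<^sup>2 + M)"
    using \<alpha> by (intro mult_left_mono) auto
  then show ?thesis
    unfolding gweight_def M_def[symmetric] exp_add[symmetric] by (simp add: field_simps)
qed

lemma bounded_weak_to_strong_affine:
  assumes p: "1 < p" and \<alpha>: "0 < \<alpha>" and a: "cmod a < 1" and \<phi>: "\<And>z. \<phi> z = a * z + b"
  shows "bounded_weak_to_strong p \<alpha> (comp_op \<phi> :: (complex \<Rightarrow> 'a::complex_banach) \<Rightarrow> complex \<Rightarrow> 'a)"
proof -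
  define E where "E = exp (\<alpha> / 2 * ((cmod b)\<^sup>2 / (1 - cmod a)))"
  define \<beta> where "\<beta> = \<alpha> * (1 - cmod a)"
  define A where "A = enn2real (gauss_mass p \<alpha>)"
  define B where "B = enn2real (gauss_mass p \<beta>)"
  have \<beta>: "0 < \<beta>" using a \<alpha> by (simp add: \<beta>_def)
  have A: "gauss_mass p \<alpha> = ennreal A" "0 < A"
    using gauss_mass_finite[of p \<alpha>] gauss_mass_pos[of p \<alpha>] p \<alpha> by (simp_all add: A_def enn2real_positive_iff)
  have B: "gauss_mass p \<beta> = ennreal B" "0 \<le> B"
    using gauss_mass_finite[of p \<beta>] p \<beta> by (simp_all add: B_def)
  \<comment> \<open>E comes from the shift b, B is the mass of the leftover Gaussian, and 1 / A
    comes from the pointwise estimate.\<close>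
  define K where "K = E powr p * B / A"
  have main: "comp_op \<phi> f \<in> fock_space p \<alpha> \<and> fock_norm p \<alpha> (comp_op \<phi> f) \<le> K powr (1 / p) * weak_fock_norm p \<alpha> f"
    if f: "f \<in> weak_fock_space p \<alpha>" for f :: "complex \<Rightarrow> 'a"
  proof -
    define W where "W = weak_fock_norm p \<alpha> f"
    have W: "0 \<le> W"
      unfolding W_def using weak_fock_norm_upper[OF f zero_in_dual_unit_ball] fock_norm_nonneg order_trans by blast
    have pt: "(norm (f w) * gweight \<alpha> w) powr p \<le> W powr p / A" for w
      using weak_fock_pointwise[OF f p, of w] A
      by (simp add: W_def field_simps flip: ennreal_mult)
    have ent: "entire (comp_op \<phi> f)"
      using entire_comp_affine[of f a b] f by (simp add: comp_op_def o_def \<phi> weak_fock_space_def)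
    have "(norm (f (\<phi> z)) * gweight \<alpha> z) powr p \<le> W powr p / A * E powr p * gweight \<beta> z powr p" for z
    proof -
      have "norm (f (\<phi> z)) * gweight \<alpha> z \<le> norm (f (\<phi> z)) * (gweight \<alpha> (\<phi> z) * (E * gweight \<beta> z))"
        using gweight_affine[OF a \<alpha>, of z b] by (intro mult_left_mono) (auto simp: E_def \<beta>_def \<phi>)
      then have "(norm (f (\<phi> z)) * gweight \<alpha> z) powr p \<le> ((norm (f (\<phi> z)) * gweight \<alpha> (\<phi> z)) * (E * gweight \<beta> z)) powr p"
        using p by (intro powr_mono2) (auto simp: mult_ac)
      also have "\<dots> = (norm (f (\<phi> z)) * gweight \<alpha> (\<phi> z)) powr p * (E powr p * gweight \<beta> z powr p)"
        by (simp add: powr_mult E_def)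
      also have "\<dots> \<le> W powr p / A * (E powr p * gweight \<beta> z powr p)"
        by (intro mult_right_mono pt) auto
      finally show ?thesis by (simp add: mult.assoc)
    qed
    then have "(\<integral>\<^sup>+z. ennreal ((norm (comp_op \<phi> f z) * gweight \<alpha> z) powr p) \<partial>lborel)
        \<le> (\<integral>\<^sup>+z. ennreal (W powr p / A * E powr p) * ennreal (gweight \<beta> z powr p) \<partial>lborel)"
      using A by (intro nn_integral_mono) (simp add: comp_op_def flip: ennreal_mult)
    also have "\<dots> = ennreal (K * W powr p)"
    proof -
      have "(\<integral>\<^sup>+z. ennreal (W powr p / A * E powr p) * ennreal (gweight \<beta> z powr p) \<partial>lborel)
          = ennreal (W powr p / A * E powr p) * ennreal B"
        unfolding B(1)[symmetric] gauss_mass_def by (rule nn_integral_cmult) measurable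
      also have "\<dots> = ennreal (K * W powr p)"
        using A B by (simp add: K_def mult_ac flip: ennreal_mult)
      finally show ?thesis .
    qed
    finally have le: "(\<integral>\<^sup>+z. ennreal ((norm (comp_op \<phi> f z) * gweight \<alpha> z) powr p) \<partial>lborel) \<le> ennreal (K * W powr p)" .
    have K: "0 \<le> K" using A B by (simp add: K_def)
    then have "(K * W powr p) powr (1 / p) = K powr (1 / p) * W"
      using W p by (simp add: powr_mult powr_powr)
    then show ?thesis
      using fock_spaceI[OF ent _ _ le] p K by (simp add: W_def)
  qed
  then show ?thesis
    unfolding bounded_weak_to_strong_def by blast
qed

section \<open>Sums of kernels at separated points\<close>

text \<open>The reproducing kernel at w of the Hilbert space with p = 2, normalised up to a constant
  independent of w.\<close>

definition fock_kernel :: "real \<Rightarrow> complex \<Rightarrow> complex \<Rightarrow> complex" where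
  "fock_kernel \<alpha> w z = exp (of_real \<alpha> * (cnj w * z)) * of_real (gweight \<alpha> w)"

lemma fock_kernel_holomorphic: "fock_kernel \<alpha> w holomorphic_on UNIV"
  unfolding fock_kernel_def by (intro holomorphic_intros)

text \<open>In weighted modulus a kernel is the Gaussian bump translated to w; this is why kernels
  at distant points hardly interact.\<close>

lemma fock_kernel_weighted: "cmod (fock_kernel \<alpha> w z) * gweight \<alpha> z = gweight \<alpha> (z - w)"
proof -
  have "gweight \<alpha> (- w) = gweight \<alpha> w" "- \<alpha> * Re (cnj z * - w) = \<alpha> * Re (cnj w * z)"
    by (simp_all add: gweight_def algebra_simps)
  then have "gweight \<alpha> (z - w) = gweight \<alpha> z * gweight \<alpha> w * exp (\<alpha> * Re (cnj w * z))"
    using gweight_add[of \<alpha> z "- w"] by simp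
  then show ?thesis
    by (simp add: fock_kernel_def norm_mult)
qed

text \<open>Composition with a rotation only rotates the centres, so it preserves their
  separation.\<close>

lemma fock_kernel_rotate: "fock_kernel \<alpha> w (a * z) = fock_kernel \<alpha> (cnj a * w) z" if "cmod a = 1"
  using that by (simp add: fock_kernel_def gweight_def norm_mult mult_ac)

text \<open>Jensen's inequality for weights g of total mass at most s, by summing the tangents at
  the weighted mean m. The unnormalised mass produces the factor s ^ (p - 1).\<close>

lemma weighted_power_mean:
  fixes c g :: "nat \<Rightarrow> real"
  assumes p: "1 < p" and c: "\<And>k. k \<in> I \<Longrightarrow> 0 \<le> c k" and g: "\<And>k. k \<in> I \<Longrightarrow> 0 \<le> g k"
    and I: "finite I" and s: "(\<Sum>k\<in>I. g k) \<le> s"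
  shows "(\<Sum>k\<in>I. c k * g k) powr p \<le> s powr (p - 1) * (\<Sum>k\<in>I. c k powr p * g k)"
proof (cases "(\<Sum>k\<in>I. g k) = 0")
  case True
  then have "\<forall>k\<in>I. g k = 0"
    using sum_nonneg_eq_0_iff[OF I, of g] g by simp
  then show ?thesis by simp
next
  case False
  define G where "G = (\<Sum>k\<in>I. g k)"
  define m where "m = (\<Sum>k\<in>I. c k * g k) / G"
  have G: "0 < G" using False g sum_nonneg[of I g] by (simp add: G_def order_less_le)
  have m: "0 \<le> m" using G c g by (simp add: m_def sum_nonneg)
  have "m powr p * G = (\<Sum>k\<in>I. (m powr p + p * m powr (p - 1) * (c k - m)) * g k)"
  proof -
    define a b where "a = m powr p" and "b = p * m powr (p - 1)"
    have "(\<Sum>k\<in>I. (a + b * (c k - m)) * g k) = (\<Sum>k\<in>I. a * g k + b * (c k * g k) - b * m * g k)"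
      by (intro sum.cong) (simp_all add: algebra_simps)
    also have "\<dots> = a * G + b * ((\<Sum>k\<in>I. c k * g k) - m * G)"
      by (simp add: G_def sum.distrib sum_subtractf right_diff_distrib flip: sum_distrib_left)
    finally have "(\<Sum>k\<in>I. (m powr p + p * m powr (p - 1) * (c k - m)) * g k)
        = m powr p * G + p * m powr (p - 1) * ((\<Sum>k\<in>I. c k * g k) - m * G)"
      by (simp add: a_def b_def)
    then show ?thesis using G by (simp add: m_def)
  qed
  also have "\<dots> \<le> (\<Sum>k\<in>I. c k powr p * g k)"
    by (intro sum_mono mult_right_mono powr_ge_tangent p m c g)
  finally have *: "m powr p * G \<le> (\<Sum>k\<in>I. c k powr p * g k)" .
  have "(\<Sum>k\<in>I. c k * g k) powr p = (m * G) powr p"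
    using G by (simp add: m_def)
  also have "\<dots> = G powr (p - 1) * (m powr p * G)"
    using m G powr_mult_base[of G "p - 1"] by (simp add: powr_mult mult_ac)
  also have "\<dots> \<le> s powr (p - 1) * (\<Sum>k\<in>I. c k powr p * g k)"
    using * G s p m by (intro mult_mono powr_mono2) (auto simp: G_def)
  finally show ?thesis .
qed

lemma powr_add_le:
  fixes a b :: real
  assumes "0 \<le> a" "0 \<le> b" "0 \<le> p"
  shows "(a + b) powr p \<le> 2 powr p * (a powr p + b powr p)"
proof -
  have "(a + b) powr p \<le> (2 * max a b) powr p"
    using assms by (intro powr_mono2) auto
  also have "\<dots> = 2 powr p * max a b powr p"
    using assms by (simp add: powr_mult)
  also have "\<dots> \<le> 2 powr p * (a powr p + b powr p)"
    by (intro mult_left_mono) (auto simp: max_def)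
  finally show ?thesis .
qed

lemma gweight_antimono:
  assumes "0 \<le> \<alpha>" "cmod z \<le> cmod w"
  shows "gweight \<alpha> w \<le> gweight \<alpha> z"
  using assms by (simp add: gweight_def mult_left_mono power_mono)

text \<open>If z is within R / 2 of one centre, all others are at least R / 2 away and together
  contribute at most \<delta>; the near one contributes at most 1.\<close>

lemma separated_gweight_sum:
  assumes \<alpha>: "0 \<le> \<alpha>" and sep: "\<And>k l. k < n \<Longrightarrow> l < n \<Longrightarrow> k \<noteq> l \<Longrightarrow> R \<le> cmod (w k - w l)"
    and \<delta>: "real n * gweight \<alpha> (of_real (R / 2)) \<le> \<delta>" and R: "0 \<le> R"
  shows "j < n \<Longrightarrow> cmod (z - w j) \<le> R / 2 \<Longrightarrow> (\<Sum>k\<in>{..<n} - {j}. gweight \<alpha> (z - w k)) \<le> \<delta>"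
    and "(\<Sum>k<n. gweight \<alpha> (z - w k)) \<le> 1 + \<delta>"
proof -
  let ?e = "gweight \<alpha> (of_real (R / 2))"
  have far: "gweight \<alpha> (z - w k) \<le> ?e" if "R / 2 \<le> cmod (z - w k)" for k
    using that R \<alpha> by (intro gweight_antimono) auto
  have sum: "(\<Sum>k\<in>I. gweight \<alpha> (z - w k)) \<le> \<delta>"
    if I: "I \<subseteq> {..<n}" and le: "\<And>k. k \<in> I \<Longrightarrow> R / 2 \<le> cmod (z - w k)" for I
  proof -
    have "(\<Sum>k\<in>I. gweight \<alpha> (z - w k)) \<le> real (card I) * ?e"
      using far le by (intro sum_bounded_above) auto
    also have "\<dots> \<le> real n * ?e"
      using card_mono[OF _ I] by (intro mult_right_mono) auto
    finally show ?thesis using \<delta> by simp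
  qed
  show near: "(\<Sum>k\<in>{..<n} - {j}. gweight \<alpha> (z - w k)) \<le> \<delta>" if j: "j < n" "cmod (z - w j) \<le> R / 2" for j
  proof (rule sum)
    fix k assume "k \<in> {..<n} - {j}"
    then have "R \<le> cmod (w j - w k)"
      using sep[of j k] j by auto
    also have "\<dots> \<le> cmod (z - w k) + cmod (z - w j)"
      using norm_triangle_ineq4[of "z - w k" "z - w j"] by simp
    finally show "R / 2 \<le> cmod (z - w k)" using j by simp
  qed auto
  show "(\<Sum>k<n. gweight \<alpha> (z - w k)) \<le> 1 + \<delta>"
  proof (cases "\<exists>j<n. cmod (z - w j) \<le> R / 2")
    case True
    then obtain j where j: "j < n" "cmod (z - w j) \<le> R / 2" by blast
    have "gweight \<alpha> (z - w j) \<le> 1"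
      using \<alpha> by (simp add: gweight_def)
    then show ?thesis
      using near[OF j] j sum.remove[of "{..<n}" j "\<lambda>k. gweight \<alpha> (z - w k)"] by simp
  next
    case False
    then have "(\<Sum>k<n. gweight \<alpha> (z - w k)) \<le> \<delta>"
      by (intro sum) auto
    then show ?thesis by simp
  qed
qed

lemma nn_integral_gweight_shift:
  "(\<integral>\<^sup>+z. ennreal (gweight \<alpha> (z - w)) \<partial>lborel) = gauss_mass 1 \<alpha>"
  using nn_integral_lborel_translate[of "\<lambda>z. ennreal (gweight \<alpha> z)" "- w"] by (simp add: gauss_mass_def)

text \<open>The power mean with the bumps as weights costs only 2 ^ (p - 1), and each shifted bump
  has mass B; no constant depends on n.\<close>

lemma kernel_sum_upper:
  fixes y :: "nat \<Rightarrow> complex"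
  assumes p: "1 < p" and sum: "\<And>z. (\<Sum>k<n. gweight \<alpha> (z - w k)) \<le> 2"
    and B: "gauss_mass 1 \<alpha> = ennreal B" "0 \<le> B"
  shows "(\<integral>\<^sup>+z. ennreal ((cmod (\<Sum>k<n. fock_kernel \<alpha> (w k) z * y k) * gweight \<alpha> z) powr p) \<partial>lborel)
      \<le> ennreal (2 powr (p - 1) * B * (\<Sum>k<n. cmod (y k) powr p))"
proof -
  have "(cmod (\<Sum>k<n. fock_kernel \<alpha> (w k) z * y k) * gweight \<alpha> z) powr p
      \<le> 2 powr (p - 1) * (\<Sum>k<n. cmod (y k) powr p * gweight \<alpha> (z - w k))" for z
  proof -
    have "cmod (\<Sum>k<n. fock_kernel \<alpha> (w k) z * y k) * gweight \<alpha> z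
        \<le> (\<Sum>k<n. cmod (fock_kernel \<alpha> (w k) z * y k)) * gweight \<alpha> z"
      by (intro mult_right_mono norm_sum) auto
    also have "\<dots> = (\<Sum>k<n. cmod (y k) * gweight \<alpha> (z - w k))"
      unfolding sum_distrib_right by (simp add: norm_mult flip: fock_kernel_weighted) (simp add: mult_ac)
    finally have "(cmod (\<Sum>k<n. fock_kernel \<alpha> (w k) z * y k) * gweight \<alpha> z) powr p
        \<le> (\<Sum>k<n. cmod (y k) * gweight \<alpha> (z - w k)) powr p"
      using p by (intro powr_mono2) auto
    also have "\<dots> \<le> 2 powr (p - 1) * (\<Sum>k<n. cmod (y k) powr p * gweight \<alpha> (z - w k))"
      by (rule weighted_power_mean[OF p _ _ _ sum]) auto
    finally show ?thesis .
  qed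
  then have "(\<integral>\<^sup>+z. ennreal ((cmod (\<Sum>k<n. fock_kernel \<alpha> (w k) z * y k) * gweight \<alpha> z) powr p) \<partial>lborel)
      \<le> (\<integral>\<^sup>+z. ennreal (2 powr (p - 1) * (\<Sum>k<n. cmod (y k) powr p * gweight \<alpha> (z - w k))) \<partial>lborel)"
    by (intro nn_integral_mono ennreal_leI)
  also have "\<dots> = (\<integral>\<^sup>+z. (\<Sum>k<n. ennreal (2 powr (p - 1) * cmod (y k) powr p) * ennreal (gweight \<alpha> (z - w k))) \<partial>lborel)"
    by (intro nn_integral_cong) (simp add: sum_distrib_left mult.assoc sum_nonneg flip: ennreal_mult)
  also have "\<dots> = (\<Sum>k<n. ennreal (2 powr (p - 1) * cmod (y k) powr p) * ennreal B)"
    by (subst nn_integral_sum) (simp_all add: nn_integral_cmult nn_integral_gweight_shift B)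
  also have "\<dots> = ennreal (2 powr (p - 1) * B * (\<Sum>k<n. cmod (y k) powr p))"
    using B by (simp add: sum_distrib_left mult_ac flip: ennreal_mult)
  finally show ?thesis .
qed

definition gauss_disc :: "real \<Rightarrow> real \<Rightarrow> ennreal" where
  "gauss_disc p \<alpha> = (\<integral>\<^sup>+z. ennreal (gweight \<alpha> z powr p) * indicator (ball 0 1) z \<partial>lborel)"

lemma gauss_disc_pos: "0 < gauss_disc p \<alpha>"
  unfolding gauss_disc_def by (intro nn_integral_pos) auto

lemma gauss_disc_finite:
  assumes "0 < p" "0 < \<alpha>"
  shows "gauss_disc p \<alpha> < \<infinity>"
proof -
  have "gauss_disc p \<alpha> \<le> gauss_mass p \<alpha>"
    unfolding gauss_disc_def gauss_mass_def by (intro nn_integral_mono) (auto split: split_indicator)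
  then show ?thesis
    using gauss_mass_finite[OF assms] by (rule order_le_less_trans)
qed

lemma gauss_disc_shift:
  "(\<integral>\<^sup>+z. ennreal (gweight \<alpha> (z - w) powr p) * indicator (ball w 1) z \<partial>lborel) = gauss_disc p \<alpha>"
proof -
  have "(\<integral>\<^sup>+z. ennreal (gweight \<alpha> (z - w) powr p) * indicator (ball w 1) z \<partial>lborel)
      = (\<integral>\<^sup>+z. ennreal (gweight \<alpha> (- w + z) powr p) * indicator (ball 0 1) (- w + z) \<partial>lborel)"
    by (intro nn_integral_cong) (auto simp: dist_norm norm_minus_commute split: split_indicator)
  moreover have [measurable]: "ball (0 :: complex) 1 \<in> sets borel"
    by simp
  ultimately show ?thesis
    using nn_integral_lborel_translate[of "\<lambda>z. ennreal (gweight \<alpha> z powr p) * indicator (ball 0 1) z" "- w"]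
    by (simp add: gauss_disc_def)
qed

text \<open>On the unit disc about w k the k-th term is the full sum minus a tail of total weight at
  most \<delta>. Integrating over the disjoint discs bounds the l^p sum by the integral of the full
  sum plus a tail term small enough to absorb.\<close>

lemma kernel_sum_lower:
  fixes x :: "nat \<Rightarrow> 'a::complex_banach"
  assumes p: "1 < p" and \<alpha>: "0 < \<alpha>"
    and sep: "\<And>k l. k < n \<Longrightarrow> l < n \<Longrightarrow> k \<noteq> l \<Longrightarrow> R \<le> cmod (w k - w l)" and R: "2 < R"
    and \<delta>: "real n * gweight \<alpha> (of_real (R / 2)) \<le> \<delta>"
    and A: "gauss_disc p \<alpha> = ennreal A" "0 < A" and B: "gauss_mass 1 \<alpha> = ennreal B" "0 \<le> B"
    and small: "2 powr p * \<delta> powr (p - 1) * B \<le> A / 2"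
    and Q: "0 \<le> Q" "(\<integral>\<^sup>+z. ennreal ((norm (\<Sum>k<n. fock_kernel \<alpha> (w k) z *\<^sub>C x k) * gweight \<alpha> z) powr p) \<partial>lborel) \<le> ennreal Q"
  shows "(\<Sum>k<n. norm (x k) powr p) \<le> 2 * 2 powr p / A * Q"
proof -
  define F where "F z = norm (\<Sum>k<n. fock_kernel \<alpha> (w k) z *\<^sub>C x k) * gweight \<alpha> z" for z
  define g where "g k z = gweight \<alpha> (z - w k)" for k z
  define s where "s = (\<Sum>k<n. norm (x k) powr p)"
  have g0: "0 \<le> g k z" for k z by (simp add: g_def)
  have F0: "0 \<le> F z" for z by (simp add: F_def)
  have [measurable]: "F \<in> borel_measurable borel" "g k \<in> borel_measurable borel" for k
    using entire_norm_measurable[OF entire_sum_scaleC[of "\<lambda>k. fock_kernel \<alpha> (w k)" x n]]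
    by (auto simp: F_def[abs_def] g_def[abs_def] fock_kernel_holomorphic)
  have [measurable]: "ball (w k) 1 \<in> sets borel" for k
    by simp
  \<comment> \<open>One majorant for all k: since the discs are disjoint, the localised terms add up
    to at most P, without a factor n.\<close>
  define P where "P z = 2 powr p * (F z powr p + \<delta> powr (p - 1) * (\<Sum>l<n. norm (x l) powr p * g l z))" for z
  have local: "(norm (x k) * g k z) powr p \<le> P z" if k: "k < n" and z: "z \<in> ball (w k) 1" for k z
  proof -
    have near: "cmod (z - w k) \<le> R / 2"
      using z R by (simp add: dist_norm norm_minus_commute)
    define T where "T = (\<Sum>l\<in>{..<n} - {k}. norm (x l) * g l z)"
    have T: "T powr p \<le> \<delta> powr (p - 1) * (\<Sum>l\<in>{..<n} - {k}. norm (x l) powr p * g l z)"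
      unfolding T_def
      using separated_gweight_sum(1)[of \<alpha> n R w, OF _ sep \<delta> _ k near] \<alpha> R g0
      by (intro weighted_power_mean p) (auto simp: g_def)
    have "fock_kernel \<alpha> (w k) z *\<^sub>C x k = (\<Sum>l<n. fock_kernel \<alpha> (w l) z *\<^sub>C x l)
        - (\<Sum>l\<in>{..<n} - {k}. fock_kernel \<alpha> (w l) z *\<^sub>C x l)"
      using k by (subst sum.remove[of _ k]) auto
    then have "norm (fock_kernel \<alpha> (w k) z *\<^sub>C x k) \<le> norm (\<Sum>l<n. fock_kernel \<alpha> (w l) z *\<^sub>C x l)
        + norm (\<Sum>l\<in>{..<n} - {k}. fock_kernel \<alpha> (w l) z *\<^sub>C x l)"
      using norm_triangle_ineq4 by metis
    also have "norm (\<Sum>l\<in>{..<n} - {k}. fock_kernel \<alpha> (w l) z *\<^sub>C x l)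
        \<le> (\<Sum>l\<in>{..<n} - {k}. norm (fock_kernel \<alpha> (w l) z *\<^sub>C x l))"
      by (rule norm_sum)
    finally have "norm (fock_kernel \<alpha> (w k) z *\<^sub>C x k) * gweight \<alpha> z \<le>
       (norm (\<Sum>l<n. fock_kernel \<alpha> (w l) z *\<^sub>C x l) + (\<Sum>l\<in>{..<n} - {k}. norm (fock_kernel \<alpha> (w l) z *\<^sub>C x l))) * gweight \<alpha> z"
      by (intro mult_right_mono) auto
    moreover have "norm (fock_kernel \<alpha> (w l) z *\<^sub>C x l) * gweight \<alpha> z = norm (x l) * g l z" for l
      by (simp add: g_def norm_scaleC flip: fock_kernel_weighted)
    ultimately have "norm (x k) * g k z \<le> F z + T"
      by (simp add: F_def T_def distrib_right sum_distrib_right)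
    then have "(norm (x k) * g k z) powr p \<le> (F z + T) powr p"
      using p g0 by (intro powr_mono2) auto
    also have "\<dots> \<le> 2 powr p * (F z powr p + T powr p)"
      using p F0 g0 by (intro powr_add_le) (auto simp: T_def intro!: sum_nonneg)
    also have "\<dots> \<le> P z"
    proof -
      have "(\<Sum>l\<in>{..<n} - {k}. norm (x l) powr p * g l z) \<le> (\<Sum>l<n. norm (x l) powr p * g l z)"
        using g0 by (intro sum_mono2) auto
      then have "\<delta> powr (p - 1) * (\<Sum>l\<in>{..<n} - {k}. norm (x l) powr p * g l z)
          \<le> \<delta> powr (p - 1) * (\<Sum>l<n. norm (x l) powr p * g l z)"
        by (intro mult_left_mono) auto
      then show ?thesis
        using T by (auto simp: P_def)
    qed
    finally show ?thesis .
  qed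
  have P0: "0 \<le> P z" for z
    using g0 by (auto simp: P_def intro!: mult_nonneg_nonneg add_nonneg_nonneg sum_nonneg)
  have disjoint: "(\<Sum>k<n. (norm (x k) * g k z) powr p * indicator (ball (w k) 1) z) \<le> P z" for z
  proof (cases "\<exists>k<n. z \<in> ball (w k) 1")
    case True
    then obtain k where k: "k < n" "z \<in> ball (w k) 1" by blast
    have "z \<notin> ball (w l) 1" if "l < n" "l \<noteq> k" for l
    proof
      assume "z \<in> ball (w l) 1"
      then have "dist (w l) (w k) < 2"
        using k dist_triangle2[of "w l" "w k" z] by (simp add: dist_commute)
      then show False
        using sep[OF that(1) k(1) that(2)] R by (simp add: dist_norm)
    qed
    then have "(\<Sum>l<n. (norm (x l) * g l z) powr p * indicator (ball (w l) 1) z)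
        = (\<Sum>l<n. if l = k then (norm (x k) * g k z) powr p else 0)"
      using k by (intro sum.cong) (auto simp: indicator_def)
    then show ?thesis
      using local[OF k] k by simp
  next
    case False
    then have "(\<Sum>l<n. (norm (x l) * g l z) powr p * indicator (ball (w l) 1) z) = 0"
      by (intro sum.neutral) auto
    then show ?thesis using P0 by simp
  qed
  have "ennreal (s * A) = (\<Sum>k<n. ennreal (norm (x k) powr p) * gauss_disc p \<alpha>)"
    using A by (simp add: s_def sum_distrib_right flip: ennreal_mult)
  also have "\<dots> = (\<Sum>k<n. \<integral>\<^sup>+z. ennreal ((norm (x k) * g k z) powr p * indicator (ball (w k) 1) z) \<partial>lborel)"
  proof (intro sum.cong refl)
    fix k
    have "ennreal (norm (x k) powr p) * gauss_disc p \<alpha>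
        = (\<integral>\<^sup>+z. ennreal (norm (x k) powr p) * (ennreal (g k z powr p) * indicator (ball (w k) 1) z) \<partial>lborel)"
      unfolding gauss_disc_shift[symmetric, of _ _ "w k"] g_def[symmetric] by (rule nn_integral_cmult[symmetric]) measurable
    also have "\<dots> = (\<integral>\<^sup>+z. ennreal ((norm (x k) * g k z) powr p * indicator (ball (w k) 1) z) \<partial>lborel)"
      using g0 by (intro nn_integral_cong) (auto simp: powr_mult ennreal_mult split: split_indicator)
    finally show "ennreal (norm (x k) powr p) * gauss_disc p \<alpha>
        = (\<integral>\<^sup>+z. ennreal ((norm (x k) * g k z) powr p * indicator (ball (w k) 1) z) \<partial>lborel)" .
  qed
  also have "\<dots> = (\<integral>\<^sup>+z. (\<Sum>k<n. ennreal ((norm (x k) * g k z) powr p * indicator (ball (w k) 1) z)) \<partial>lborel)"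
    by (rule nn_integral_sum[symmetric]) measurable
  also have "\<dots> \<le> (\<integral>\<^sup>+z. ennreal (P z) \<partial>lborel)"
    using disjoint by (intro nn_integral_mono) (simp add: ennreal_leI)
  also have "\<dots> = (\<integral>\<^sup>+z. ennreal (2 powr p) * ennreal (F z powr p)
      + (\<Sum>l<n. ennreal (2 powr p * \<delta> powr (p - 1) * norm (x l) powr p) * ennreal (g l z)) \<partial>lborel)"
  proof (rule nn_integral_cong)
    fix z
    have "ennreal (P z) = ennreal (2 powr p * F z powr p + (\<Sum>l<n. (2 powr p * \<delta> powr (p - 1) * norm (x l) powr p) * g l z))"
      by (simp add: P_def distrib_left sum_distrib_left mult.assoc)
    also have "\<dots> = ennreal (2 powr p * F z powr p) + (\<Sum>l<n. ennreal ((2 powr p * \<delta> powr (p - 1) * norm (x l) powr p) * g l z))"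
      using g0 by (subst ennreal_plus) (auto intro!: sum_nonneg mult_nonneg_nonneg)
    also have "\<dots> = ennreal (2 powr p) * ennreal (F z powr p)
      + (\<Sum>l<n. ennreal (2 powr p * \<delta> powr (p - 1) * norm (x l) powr p) * ennreal (g l z))"
      using g0 by (simp add: ennreal_mult)
    finally show "ennreal (P z) = ennreal (2 powr p) * ennreal (F z powr p)
      + (\<Sum>l<n. ennreal (2 powr p * \<delta> powr (p - 1) * norm (x l) powr p) * ennreal (g l z))" .
  qed
  also have "\<dots> = ennreal (2 powr p) * (\<integral>\<^sup>+z. ennreal (F z powr p) \<partial>lborel)
      + (\<Sum>l<n. ennreal (2 powr p * \<delta> powr (p - 1) * norm (x l) powr p) * ennreal B)"
    by (simp add: nn_integral_add nn_integral_cmult nn_integral_sum)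
      (simp add: g_def nn_integral_gweight_shift B)
  also have "\<dots> \<le> ennreal (2 powr p) * ennreal Q
      + (\<Sum>l<n. ennreal (2 powr p * \<delta> powr (p - 1) * norm (x l) powr p) * ennreal B)"
    using Q(2) by (intro add_right_mono mult_left_mono) (auto simp: F_def)
  also have "\<dots> = ennreal (2 powr p * Q + 2 powr p * \<delta> powr (p - 1) * B * s)"
  proof -
    have "(\<Sum>l<n. ennreal (2 powr p * \<delta> powr (p - 1) * norm (x l) powr p) * ennreal B)
        = (\<Sum>l<n. ennreal (2 powr p * \<delta> powr (p - 1) * B * norm (x l) powr p))"
      using B by (intro sum.cong) (simp_all add: mult_ac flip: ennreal_mult)
    also have "\<dots> = ennreal (2 powr p * \<delta> powr (p - 1) * B * s)"
      using B by (subst sum_ennreal) (simp_all add: s_def sum_distrib_left)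
    finally show ?thesis
      using B Q(1) by (simp add: s_def sum_nonneg ennreal_mult)
  qed
  finally have "s * A \<le> 2 powr p * Q + 2 powr p * \<delta> powr (p - 1) * B * s"
    using B Q(1) by (subst (asm) ennreal_le_iff) (auto simp: s_def intro!: add_nonneg_nonneg mult_nonneg_nonneg sum_nonneg)
  \<comment> \<open>The tail takes at most half of s * A, hence the factor 2 in the
    conclusion.\<close>
  also have "2 powr p * \<delta> powr (p - 1) * B * s \<le> A / 2 * s"
    using small by (intro mult_right_mono) (auto simp: s_def intro!: sum_nonneg)
  finally have "s * A \<le> 2 * (2 powr p * Q)"
    by (simp add: mult.commute[of A s])
  then show ?thesis
    using A(2) by (simp add: s_def field_simps)
qed

section \<open>Necessity\<close>

lemma exists_separation:
  assumes "0 < \<alpha>" "0 < \<delta>"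
  obtains R where "2 < R" "real n * gweight \<alpha> (of_real (R / 2)) \<le> \<delta>"
proof -
  have "((\<lambda>R. real n * exp (- (\<alpha> / 2) * (R / 2)\<^sup>2)) \<longlongrightarrow> 0) at_top"
    using \<open>0 < \<alpha>\<close> by real_asymp
  then have "\<forall>\<^sub>F R in at_top. real n * exp (- (\<alpha> / 2) * (R / 2)\<^sup>2) < \<delta>"
    using \<open>0 < \<delta>\<close> by (rule order_tendstoD)
  then have "\<forall>\<^sub>F R in at_top. real n * exp (- (\<alpha> / 2) * (R / 2)\<^sup>2) < \<delta> \<and> 2 < R"
    using eventually_gt_at_top by (rule eventually_conj)
  then obtain R where "real n * exp (- (\<alpha> / 2) * (R / 2)\<^sup>2) < \<delta>" "2 < R"
    using eventually_happens'[OF trivial_limit_at_top_linorder] by blast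
  moreover have "gweight \<alpha> (of_real (R / 2)) = exp (- (\<alpha> / 2) * (R / 2)\<^sup>2)"
    by (simp add: gweight_def power_divide)
  ultimately show ?thesis
    using that[of R] by simp
qed

text \<open>A nonnegative constant permits replacing the weak norm by any upper bound V.\<close>

lemma bounded_weak_to_strong_bound:
  assumes "bounded_weak_to_strong p \<alpha> T"
  shows "\<exists>C\<ge>0. \<forall>f\<in>weak_fock_space p \<alpha>. T f \<in> fock_space p \<alpha> \<and>
    (\<forall>V\<ge>0. weak_fock_norm p \<alpha> f \<le> V \<longrightarrow> fock_norm p \<alpha> (T f) \<le> C * V)"
proof -
  obtain C where C: "\<And>f. f \<in> weak_fock_space p \<alpha> \<Longrightarrow> fock_norm p \<alpha> (T f) \<le> C * weak_fock_norm p \<alpha> f"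
    using assms by (auto simp: bounded_weak_to_strong_def)
  show ?thesis
  proof (intro exI[of _ "max C 0"] conjI ballI allI impI)
    show "T f \<in> fock_space p \<alpha>" if "f \<in> weak_fock_space p \<alpha>" for f
      using assms that by (auto simp: bounded_weak_to_strong_def)
    show "fock_norm p \<alpha> (T f) \<le> max C 0 * V"
      if f: "f \<in> weak_fock_space p \<alpha>" and V: "0 \<le> V" "weak_fock_norm p \<alpha> f \<le> V" for f V
    proof -
      have W: "0 \<le> weak_fock_norm p \<alpha> f"
        using weak_fock_norm_upper[OF f zero_in_dual_unit_ball] fock_norm_nonneg order_trans by blast
      have "fock_norm p \<alpha> (T f) \<le> C * weak_fock_norm p \<alpha> f" by (rule C[OF f])
      also have "\<dots> \<le> max C 0 * V"
        using V W by (intro mult_mono) auto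
      finally show ?thesis .
    qed
  qed simp
qed

text \<open>Serves both halves of necessity: one kernel gives the growth of the symbol, many
  separated kernels exclude rotations. D is chosen before n, the centres and the vectors.\<close>

lemma bounded_kernel_sum:
  fixes \<phi> :: "complex \<Rightarrow> complex"
  assumes p: "1 < p" and \<alpha>: "0 < \<alpha>"
    and bdd: "bounded_weak_to_strong p \<alpha> (comp_op \<phi> :: (complex \<Rightarrow> 'a::complex_banach) \<Rightarrow> complex \<Rightarrow> 'a)"
  shows "\<exists>D\<ge>0. \<forall>n w (x :: nat \<Rightarrow> 'a) S. (\<forall>z. (\<Sum>k<n. gweight \<alpha> (z - w k)) \<le> 2) \<longrightarrow>
      (\<forall>x'\<in>dual_unit_ball. (\<Sum>k<n. cmod (x' (x k)) powr p) \<le> S) \<longrightarrow>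
      (\<integral>\<^sup>+z. ennreal ((norm (\<Sum>k<n. fock_kernel \<alpha> (w k) (\<phi> z) *\<^sub>C x k) * gweight \<alpha> z) powr p) \<partial>lborel) \<le> ennreal (D * S)"
proof -
  obtain C where C: "0 \<le> C" "\<forall>f\<in>weak_fock_space p \<alpha>. comp_op \<phi> (f :: complex \<Rightarrow> 'a) \<in> fock_space p \<alpha> \<and>
      (\<forall>V\<ge>0. weak_fock_norm p \<alpha> f \<le> V \<longrightarrow> fock_norm p \<alpha> (comp_op \<phi> f) \<le> C * V)"
    using bounded_weak_to_strong_bound[OF bdd] by blast
  define B where "B = enn2real (gauss_mass 1 \<alpha>)"
  have B: "gauss_mass 1 \<alpha> = ennreal B" "0 \<le> B"
    using gauss_mass_finite[of 1 \<alpha>] \<alpha> by (simp_all add: B_def)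
  define D where "D = C powr p * (2 powr (p - 1) * B)"
  show ?thesis
  proof (intro exI[of _ D] conjI allI impI)
    show "0 \<le> D" using B by (simp add: D_def)
    fix n and w :: "nat \<Rightarrow> complex" and x :: "nat \<Rightarrow> 'a" and S :: real
    assume sum2: "\<forall>z. (\<Sum>k<n. gweight \<alpha> (z - w k)) \<le> 2"
      and S: "\<forall>x'\<in>dual_unit_ball. (\<Sum>k<n. cmod (x' (x k)) powr p) \<le> S"
    define f where "f z = (\<Sum>k<n. fock_kernel \<alpha> (w k) z *\<^sub>C x k)" for z
    define V where "V = 2 powr (p - 1) * B * S"
    have "0 \<le> S"
      using bspec[OF S zero_in_dual_unit_ball] p by simp
    then have V: "0 \<le> V" using B by (simp add: V_def)
    have ent: "entire f"
      unfolding f_def by (intro entire_sum_scaleC fock_kernel_holomorphic)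
    have weak: "(\<integral>\<^sup>+z. ennreal ((cmod (x' (f z)) * gweight \<alpha> z) powr p) \<partial>lborel) \<le> ennreal V"
      if x': "x' \<in> dual_unit_ball" for x'
    proof -
      interpret bounded_linear x' by (rule dual_unit_ball_bounded_linear[OF x'])
      have "x' (f z) = (\<Sum>k<n. fock_kernel \<alpha> (w k) z * x' (x k))" for z
        by (simp add: f_def sum dual_unit_ball_scaleC[OF x'])
      then have "(\<integral>\<^sup>+z. ennreal ((cmod (x' (f z)) * gweight \<alpha> z) powr p) \<partial>lborel)
          \<le> ennreal (2 powr (p - 1) * B * (\<Sum>k<n. cmod (x' (x k)) powr p))"
        using kernel_sum_upper[OF p sum2[rule_format] B, of "\<lambda>k. x' (x k)"] by simp
      also have "\<dots> \<le> ennreal V"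
        unfolding V_def using S x' B by (intro ennreal_leI mult_left_mono) auto
      finally show ?thesis .
    qed
    note f = weak_fock_spaceI[OF ent _ V weak]
    have mem: "f \<in> weak_fock_space p \<alpha>"
      using f(1) p by simp
    have "fock_norm p \<alpha> (comp_op \<phi> f) \<le> C * V powr (1 / p)"
      using f(2) p C(2) mem by simp
    then have "fock_norm p \<alpha> (comp_op \<phi> f) powr p \<le> (C * V powr (1 / p)) powr p"
      using p by (intro powr_mono2) (auto simp: fock_norm_nonneg)
    also have "\<dots> = C powr p * V"
      using C(1) V p by (simp add: powr_mult powr_powr)
    also have "\<dots> = D * S"
      by (simp add: D_def V_def)
    finally have "ennreal (fock_norm p \<alpha> (comp_op \<phi> f) powr p) \<le> ennreal (D * S)"
      by (rule ennreal_leI)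
    then show "(\<integral>\<^sup>+z. ennreal ((norm (\<Sum>k<n. fock_kernel \<alpha> (w k) (\<phi> z) *\<^sub>C x k) * gweight \<alpha> z) powr p) \<partial>lborel) \<le> ennreal (D * S)"
      using fock_norm_powr[OF conjunct1[OF bspec[OF C(2) mem]]] p by (simp add: comp_op_def f_def)
  qed
qed

text \<open>The kernel is centred at w = \<phi> z. The pointwise estimate for its image, evaluated
  at z, bounds exp (\<alpha> / 2 * (|\<phi> z| ^ 2 - |z| ^ 2)) uniformly in z.\<close>

lemma bounded_comp_op_growth:
  fixes \<phi> :: "complex \<Rightarrow> complex" and x0 :: "'a::complex_banach"
  assumes p: "1 < p" and \<alpha>: "0 < \<alpha>" and \<phi>: "\<phi> holomorphic_on UNIV" and x0: "x0 \<noteq> 0"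
    and bdd: "bounded_weak_to_strong p \<alpha> (comp_op \<phi> :: (complex \<Rightarrow> 'a) \<Rightarrow> complex \<Rightarrow> 'a)"
  obtains M where "0 \<le> M" "\<And>z. (cmod (\<phi> z))\<^sup>2 \<le> (cmod z)\<^sup>2 + M"
proof -
  obtain D where D: "0 \<le> D"
    and ker: "\<forall>n w (x :: nat \<Rightarrow> 'a) S. (\<forall>z. (\<Sum>k<n. gweight \<alpha> (z - w k)) \<le> 2) \<longrightarrow>
      (\<forall>x'\<in>dual_unit_ball. (\<Sum>k<n. cmod (x' (x k)) powr p) \<le> S) \<longrightarrow>
      (\<integral>\<^sup>+z. ennreal ((norm (\<Sum>k<n. fock_kernel \<alpha> (w k) (\<phi> z) *\<^sub>C x k) * gweight \<alpha> z) powr p) \<partial>lborel) \<le> ennreal (D * S)"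
    using bounded_kernel_sum[OF p \<alpha> bdd] by blast
  define A where "A = enn2real (gauss_mass p \<alpha>)"
  have A: "gauss_mass p \<alpha> = ennreal A" "0 < A"
    using gauss_mass_finite[of p \<alpha>] gauss_mass_pos[of p \<alpha>] p \<alpha> by (simp_all add: A_def enn2real_positive_iff)
  obtain x' where x': "x' \<in> dual_unit_ball" "cmod (x' x0) = norm x0"
    using norming_functional by blast
  \<comment> \<open>At least 1, so that ln E, and with it M, is nonnegative.\<close>
  define E where "E = max 1 (D / A)"
  have main: "(gweight \<alpha> z / gweight \<alpha> (\<phi> z)) powr p \<le> E" for z
  proof -
    define w where "w = \<phi> z"
    have le1: "gweight \<alpha> v \<le> 1" for v
      using \<alpha> by (simp add: gweight_def)
    have "(\<Sum>k<(1::nat). gweight \<alpha> (z - w)) \<le> 2" for z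
      using le1[of "z - w"] by simp
    moreover have "(\<Sum>k<(1::nat). cmod (x' x0) powr p) \<le> norm x0 powr p" if "x' \<in> dual_unit_ball" for x'
      using dual_unit_ball_le[OF that, of x0] p by (simp add: powr_mono2)
    ultimately have int: "(\<integral>\<^sup>+u. ennreal ((norm (fock_kernel \<alpha> w (\<phi> u) *\<^sub>C x0) * gweight \<alpha> u) powr p) \<partial>lborel) \<le> ennreal (D * norm x0 powr p)"
      using ker[rule_format, where n = 1 and w = "\<lambda>_. w" and x = "\<lambda>_. x0" and S = "norm x0 powr p"] by simp
    define h where "h u = fock_kernel \<alpha> w (\<phi> u) * x' x0" for u
    have "h holomorphic_on UNIV"
      unfolding h_def fock_kernel_def by (intro holomorphic_intros \<phi>)
    from fock_pointwise[OF this p, of z \<alpha>]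
    have "ennreal ((cmod (h z) * gweight \<alpha> z) powr p) * gauss_mass p \<alpha> \<le> ennreal (D * norm x0 powr p)"
      using int by (simp add: h_def norm_mult norm_scaleC x'(2))
    then have "(cmod (h z) * gweight \<alpha> z) powr p * A \<le> D * norm x0 powr p"
      using A D by (simp flip: ennreal_mult)
    moreover have "cmod (fock_kernel \<alpha> w w) = 1 / gweight \<alpha> w"
      using fock_kernel_weighted[of \<alpha> w w] by (simp add: field_simps) (simp add: gweight_def)
    then have "cmod (h z) * gweight \<alpha> z = norm x0 * (gweight \<alpha> z / gweight \<alpha> w)"
      by (simp add: h_def norm_mult x'(2) flip: w_def)
    ultimately have "(norm x0 * (gweight \<alpha> z / gweight \<alpha> w)) powr p * A \<le> D * norm x0 powr p"
      by (simp only:)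
    then have "norm x0 powr p * ((gweight \<alpha> z / gweight \<alpha> w) powr p * A) \<le> norm x0 powr p * D"
      unfolding powr_mult by (simp add: mult_ac)
    then have "(gweight \<alpha> z / gweight \<alpha> w) powr p * A \<le> D"
      using x0 by simp
    then show ?thesis
      using A by (simp add: E_def w_def field_simps le_max_iff_disj)
  qed
  define M where "M = 2 * ln E / (p * \<alpha>)"
  have E: "1 \<le> E" by (simp add: E_def)
  show ?thesis
  proof (rule that[of M])
    show "0 \<le> M" using E p \<alpha> by (simp add: M_def)
    fix z
    have "(gweight \<alpha> z / gweight \<alpha> (\<phi> z)) powr p = exp (p * \<alpha> / 2 * ((cmod (\<phi> z))\<^sup>2 - (cmod z)\<^sup>2))"
      by (simp add: powr_divide gweight_powr algebra_simps flip: exp_diff)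
    with main[of z] have "exp (p * \<alpha> / 2 * ((cmod (\<phi> z))\<^sup>2 - (cmod z)\<^sup>2)) \<le> E"
      by simp
    then have "p * \<alpha> / 2 * ((cmod (\<phi> z))\<^sup>2 - (cmod z)\<^sup>2) \<le> ln E"
      using E by (subst ln_ge_iff) auto
    then show "(cmod (\<phi> z))\<^sup>2 \<le> (cmod z)\<^sup>2 + M"
      using p \<alpha> by (simp add: M_def field_simps)
  qed
qed

lemma growth_imp_affine:
  fixes \<phi> :: "complex \<Rightarrow> complex"
  assumes \<phi>: "\<phi> holomorphic_on UNIV" and M: "0 \<le> M" "\<And>z. (cmod (\<phi> z))\<^sup>2 \<le> (cmod z)\<^sup>2 + M"
  obtains a b where "\<And>z. \<phi> z = a * z + b" "cmod a < 1 \<or> cmod a = 1 \<and> b = 0"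
proof -
  define a where "a = deriv \<phi> 0"
  define b where "b = \<phi> 0"
  have "cmod (\<phi> z) \<le> sqrt (1 + M) * cmod z ^ 1" if "1 \<le> cmod z" for z
  proof -
    have "(cmod (\<phi> z))\<^sup>2 \<le> (cmod z)\<^sup>2 + M * (cmod z)\<^sup>2"
      using M(2)[of z] mult_left_mono[of 1 "(cmod z)\<^sup>2" M] that M(1) by (simp add: one_le_power)
    also have "\<dots> = (sqrt (1 + M) * cmod z)\<^sup>2"
      using M(1) by (simp add: power_mult_distrib algebra_simps)
    finally have "cmod (\<phi> z) \<le> sqrt (1 + M) * cmod z"
      by (rule power2_le_imp_le) (use M(1) in simp)
    then show ?thesis by simp
  qed
  then have aff: "\<phi> z = a * z + b" for z
    using Liouville_polynomial[OF \<phi>, of 1 "sqrt (1 + M)" 1 z] by (simp add: a_def b_def)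
  have bound: "(cmod (a * z + b))\<^sup>2 \<le> (cmod z)\<^sup>2 + M" for z
    using M(2)[of z] by (simp add: aff)
  have lin0: "c \<le> 0" if "\<And>t. 0 \<le> t \<Longrightarrow> c * t \<le> M" for c :: real
  proof (rule ccontr)
    assume "\<not> c \<le> 0"
    then show False
      using that[of "(M + 1) / c"] M(1) by simp
  qed
  have "((cmod a)\<^sup>2 - 1) * t \<le> M" if t: "0 \<le> t" for t
  proof -
    define z where "z = complex_of_real (sqrt t)"
    define P where "P = (cmod (a * z))\<^sup>2"
    define Q where "Q = (cmod b)\<^sup>2"
    have "0 \<le> Q" by (simp add: Q_def)
    \<comment> \<open>The parallelogram law: averaging over z and - z removes the cross term with
      b.\<close>
    have "2 * P + 2 * Q = (cmod (a * z + b))\<^sup>2 + (cmod (a * (- z) + b))\<^sup>2"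
      unfolding P_def Q_def cmod_power2 by (simp add: power2_eq_square algebra_simps)
    also have "\<dots> \<le> 2 * ((cmod z)\<^sup>2 + M)"
      using bound[of z] bound[of "- z"] by simp
    also have "(cmod z)\<^sup>2 = t"
      using t by (simp add: z_def)
    finally have "P \<le> t + M"
      using \<open>0 \<le> Q\<close> by simp
    then show ?thesis
      using t by (simp add: P_def norm_mult power_mult_distrib z_def algebra_simps)
  qed
  then have "(cmod a)\<^sup>2 \<le> 1"
    using lin0[of "(cmod a)\<^sup>2 - 1"] by simp
  then have a1: "cmod a \<le> 1"
    by (simp add: power_le_one_iff abs_square_le_1)
  have "b = 0" if a: "cmod a = 1"
  proof -
    have "2 * (cmod b)\<^sup>2 * t \<le> M" if t: "0 \<le> t" for t
    proof -
      \<comment> \<open>With |a| = 1 this gives a z = t b, aligned with b, so the bound would be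
        violated by a term linear in t unless b = 0.\<close>
      define z where "z = of_real t * (cnj a * b)"
      have "a * cnj a = 1"
        using a complex_norm_square[of a] by simp
      then have "a * z + b = of_real (t + 1) * b"
        by (simp add: z_def mult.left_commute[of a] mult.assoc[symmetric] distrib_right)
      then have "(cmod b * (t + 1))\<^sup>2 \<le> (cmod b * t)\<^sup>2 + M"
        using bound[of z] t a by (simp add: z_def norm_mult mult.commute del: of_real_add)
      then have "2 * (cmod b)\<^sup>2 * t + (cmod b)\<^sup>2 \<le> M"
        by (simp add: power2_eq_square algebra_simps)
      then show ?thesis
        using zero_le_power2[of "cmod b"] by linarith
    qed
    from lin0[OF this] show ?thesis by simp
  qed
  then show ?thesis
    using that aff a1 by force
qed

lemma not_bounded_rotation:
  assumes p: "1 < p" "p < 2" and \<alpha>: "0 < \<alpha>" and a: "cmod a = 1" and \<phi>: "\<And>z. \<phi> z = a * z"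
    and inf: "infinite_dimensional TYPE('a::complex_banach)"
  shows "\<not> bounded_weak_to_strong p \<alpha> (comp_op \<phi> :: (complex \<Rightarrow> 'a) \<Rightarrow> complex \<Rightarrow> 'a)"
proof
  assume bdd: "bounded_weak_to_strong p \<alpha> (comp_op \<phi> :: (complex \<Rightarrow> 'a) \<Rightarrow> complex \<Rightarrow> 'a)"
  obtain D where D: "0 \<le> D"
    and ker: "\<forall>n w (x :: nat \<Rightarrow> 'a) S. (\<forall>z. (\<Sum>k<n. gweight \<alpha> (z - w k)) \<le> 2) \<longrightarrow>
      (\<forall>x'\<in>dual_unit_ball. (\<Sum>k<n. cmod (x' (x k)) powr p) \<le> S) \<longrightarrow>
      (\<integral>\<^sup>+z. ennreal ((norm (\<Sum>k<n. fock_kernel \<alpha> (w k) (\<phi> z) *\<^sub>C x k) * gweight \<alpha> z) powr p) \<partial>lborel) \<le> ennreal (D * S)"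
    using bounded_kernel_sum[OF p(1) \<alpha> bdd] by blast
  define A where "A = enn2real (gauss_disc p \<alpha>)"
  define B where "B = enn2real (gauss_mass 1 \<alpha>)"
  have A: "gauss_disc p \<alpha> = ennreal A" "0 < A"
    using gauss_disc_finite[of p \<alpha>] gauss_disc_pos[of p \<alpha>] p \<alpha> by (simp_all add: A_def enn2real_positive_iff)
  have B: "gauss_mass 1 \<alpha> = ennreal B" "0 < B"
    using gauss_mass_finite[of 1 \<alpha>] gauss_mass_pos[of 1 \<alpha>] \<alpha> by (simp_all add: B_def enn2real_positive_iff)
  \<comment> \<open>The value for which 2 ^ p * d * B = A / 2, the absorption condition of the lower
    estimate.\<close>
  define d where "d = A / (2 * 2 powr p * B)"
  \<comment> \<open>The bound 1 keeps the sum of bumps below 2 for the upper estimate; the other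
    bound gives \<delta> ^ (p - 1) \<le> d for the lower one.\<close>
  define \<delta> where "\<delta> = min 1 (d powr (1 / (p - 1)))"
  have d: "0 < d" using A B by (simp add: d_def)
  then have \<delta>: "0 < \<delta>" "\<delta> \<le> 1" by (auto simp: \<delta>_def)
  have "\<delta> powr (p - 1) \<le> (d powr (1 / (p - 1))) powr (p - 1)"
    using p \<delta> by (intro powr_mono2) (auto simp: \<delta>_def)
  then have "\<delta> powr (p - 1) \<le> d"
    using p d by (simp add: powr_powr)
  then have small: "2 powr p * \<delta> powr (p - 1) * B \<le> A / 2"
    using B by (simp add: d_def field_simps)
  \<comment> \<open>The constant is the one produced by chaining the lower estimate with the
    boundedness estimate.\<close>
  obtain xs :: "'a list" and S where S: "\<forall>x'\<in>dual_unit_ball. (\<Sum>x\<leftarrow>xs. cmod (x' x) powr p) \<le> S"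
    and large: "2 * 2 powr p / A * D * S < (\<Sum>x\<leftarrow>xs. norm x powr p)"
    using identity_not_summing[OF inf p, of "2 * 2 powr p / A * D"] by blast
  define n where "n = length xs"
  have conv: "(\<Sum>x\<leftarrow>xs. g x) = (\<Sum>k<n. g (xs ! k))" for g :: "'a \<Rightarrow> real"
    by (simp add: n_def sum_list_sum_nth atLeast0LessThan)
  obtain R where R: "2 < R" "real n * gweight \<alpha> (of_real (R / 2)) \<le> \<delta>"
    using exists_separation[OF \<alpha> \<delta>(1)] by blast
  \<comment> \<open>Stated for any unimodular c: c = 1 serves the original centres and c = cnj a the
    rotated ones.\<close>
  have sep: "R \<le> cmod (c * of_real (R * real k) - c * of_real (R * real l))" if "k \<noteq> l" "cmod c = 1" for k l c
  proof -
    have "c * of_real (R * real k) - c * of_real (R * real l) = c * of_real (R * (real k - real l))"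
      by (simp add: algebra_simps)
    then have "cmod (c * of_real (R * real k) - c * of_real (R * real l)) = R * \<bar>real k - real l\<bar>"
      using R that(2) by (simp only: norm_mult norm_of_real abs_mult)
    moreover have "1 \<le> \<bar>real k - real l\<bar>"
      using that(1) by linarith
    ultimately show ?thesis
      using R mult_left_mono[of 1 "\<bar>real k - real l\<bar>" R] by simp
  qed
  \<comment> \<open>The factor 1 makes the definition match \<open>sep\<close> with c = 1.\<close>
  define w where "w k = 1 * complex_of_real (R * real k)" for k
  have two: "(\<Sum>k<n. gweight \<alpha> (z - w k)) \<le> 2" for z
    using separated_gweight_sum(2)[of \<alpha> n R w \<delta> z] sep[of _ _ 1] \<alpha> R \<delta> by (force simp: w_def)
  have S0: "0 \<le> S"
    using bspec[OF S zero_in_dual_unit_ball] p by (simp add: conv)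
  have "(\<integral>\<^sup>+z. ennreal ((norm (\<Sum>k<n. fock_kernel \<alpha> (w k) (\<phi> z) *\<^sub>C xs ! k) * gweight \<alpha> z) powr p) \<partial>lborel) \<le> ennreal (D * S)"
    using S by (intro ker[rule_format] two) (simp add: conv)
  then have "(\<integral>\<^sup>+z. ennreal ((norm (\<Sum>k<n. fock_kernel \<alpha> (cnj a * w k) z *\<^sub>C xs ! k) * gweight \<alpha> z) powr p) \<partial>lborel) \<le> ennreal (D * S)"
    by (simp add: \<phi> fock_kernel_rotate[OF a])
  then have "(\<Sum>k<n. norm (xs ! k) powr p) \<le> 2 * 2 powr p / A * (D * S)"
    using sep[of _ _ "cnj a"] a R D S0 B
    by (intro kernel_sum_lower[OF p(1) \<alpha> _ R A B(1) _ small]) (auto simp: w_def)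
  then show False
    using large by (simp add: conv)
qed

theorem theorem4p5:
  fixes p \<alpha> :: real and \<phi> :: "complex \<Rightarrow> complex"
  assumes "1 < p" and "p < 2" and "\<alpha> > 0"
    and "\<phi> holomorphic_on UNIV"
    and "infinite_dimensional TYPE('a::complex_banach)"
  shows "bounded_weak_to_strong p \<alpha>
           (comp_op \<phi> :: (complex \<Rightarrow> 'a) \<Rightarrow> complex \<Rightarrow> 'a) \<longleftrightarrow>
         (\<exists>a b. (\<forall>z. \<phi> z = a * z + b) \<and> cmod a < 1)"
proof
  assume bdd: "bounded_weak_to_strong p \<alpha> (comp_op \<phi> :: (complex \<Rightarrow> 'a) \<Rightarrow> complex \<Rightarrow> 'a)"
  interpret vector_space "scaleC :: complex \<Rightarrow> 'a \<Rightarrow> 'a"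
    by (rule vector_space_scaleC)
  \<comment> \<open>The growth estimate needs a direction for its test kernels; the zero space is
    spanned by the empty set.\<close>
  have "\<exists>x0 :: 'a. x0 \<noteq> 0"
  proof (rule ccontr)
    assume "\<nexists>x0 :: 'a. x0 \<noteq> 0"
    then have "span {} = (UNIV :: 'a set)"
      by auto
    then show False
      using \<open>infinite_dimensional TYPE('a)\<close> by (metis finite.emptyI infinite_dimensional_def)
  qed
  then obtain x0 :: 'a where "x0 \<noteq> 0" ..
  then obtain M where "0 \<le> M" "\<And>z. (cmod (\<phi> z))\<^sup>2 \<le> (cmod z)\<^sup>2 + M"
    using bounded_comp_op_growth[OF assms(1,3,4) _ bdd] by blast
  then obtain a b where ab: "\<And>z. \<phi> z = a * z + b" "cmod a < 1 \<or> cmod a = 1 \<and> b = 0"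
    using growth_imp_affine[OF assms(4)] by blast
  moreover have "\<not> (cmod a = 1 \<and> b = 0)"
    using not_bounded_rotation[OF assms(1-3) _ _ assms(5), of a \<phi>] bdd ab(1) by auto
  ultimately show "\<exists>a b. (\<forall>z. \<phi> z = a * z + b) \<and> cmod a < 1"
    by blast
next
  assume "\<exists>a b. (\<forall>z. \<phi> z = a * z + b) \<and> cmod a < 1"
  then show "bounded_weak_to_strong p \<alpha> (comp_op \<phi> :: (complex \<Rightarrow> 'a) \<Rightarrow> complex \<Rightarrow> 'a)"
    using bounded_weak_to_strong_affine assms(1,3) by blast
qed

end
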